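(* Let $q$ be a primitive root of unity of even order $N=2n>2$, where $n$ is even, and let $W=L(n,n+1)$ be the four-dimensional simple $\mathrm u_q(\mathfrak{sl}_{2,\mathbb I})$-module. For every integer $b\ge1$, the link invariant $\mathrm I_W$ of the torus link $\mathcal T_{2,-b}$ is $$\mathrm I_W(\mathcal T_{2,-b})=(-1)^{b+1}\Big(b+2\sum_{i=1}^{b-1}(b-i)q^{-i}\Big).$$
   Context: $\Bbbk$ is an algebraically closed field of characteristic zero. $\mathrm u_q=\mathrm u_q(\mathfrak{sl}_{2,\mathbb I})$, $\mathbb I=\{1,2\}$, is the Hopf algebra over $\Bbbk$ generated by $x_1,x_2,y_1,y_2,\kappa_1,\kappa_2$ with relations $\kappa_1\kappa_2=\kappa_2\kappa_1$, $\kappa_i^N=1$, $\kappa_ix_j=q^{\delta_{ij}}x_j\kappa_i$, $\kappa_iy_j=q^{-\delta_{ij}}y_j\kappa_i$, $x_1^2=x_2^2=0$, $(x_1x_2)^N=-(x_2x_1)^N$, $y_1^2=y_2^2=0$, $(y_1y_2)^N=-(y_2y_1)^N$, $y_1x_1+x_1y_1=1-\kappa_2$, $y_2x_2+x_2y_2=1-\kappa_1$, $y_2x_1=q\,x_1y_2$, $y_1x_2=x_2y_1$, and coproduct $\Delta(\kappa_i)=\kappa_i\otimes\kappa_i$, $\Delta(x_1)=x_1\otimes1+\kappa_1^n\kappa_2\otimes x_1$, $\Delta(x_2)=x_2\otimes1+\kappa_2^n\otimes x_2$, $\Delta(y_1)=y_1\otimes1+\kappa_1^n\otimes y_1$, $\Delta(y_2)=y_2\otimes1+\kappa_1\kappa_2^n\otimes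 y_2$. Its antipode is denoted $S$. Its universal $R$-matrix is $R=\sum_{b_1,b_2\in\{0,1\}}\sum_{b=0}^{N-1}\sum_{(i_1,i_2)\in(\mathbb Z/N)^2}\kappa_1^{ni_1+i_2}\kappa_2^{ni_2}\,y_2^{b_2}y_{12}^{(b)}y_1^{b_1}\otimes x_1^{b_1}x_{21}^{b}x_2^{b_2}\,\delta_{(i_1,i_2)}$, where $y_{12}=y_1y_2-qy_2y_1$, $y_{12}^{(b)}=y_{12}^b/((1-q)^b[b]_q!)$, $[b]_q=1+q+\dots+q^{b-1}$, $x_{21}=x_2x_1-x_1x_2$, and $\delta_{(i_1,i_2)}$ is the idempotent projecting onto the joint eigenspace $\kappa_1=q^{i_1}$, $\kappa_2=q^{i_2}$. Writing $R=R^{(1)}\otimes R^{(2)}$ (sum implicit), the braiding is $\Psi_{V,V'}(v\otimes v')=R^{(2)}v'\otimes R^{(1)}v$. The ribbon twist is $\theta_V(v)=\nu u^{-1}v$ with $\nu=\kappa_1^n\kappa_2^n$ and $u=S(R^{(2)})R^{(1)}$; the resulting pivotal structure is the action of $\nu$ followed by the canonical isomorphism $V\cong V^{**}$ of vector spaces. $W=L(n,n+1)$ is the (unique up to isomorphism) simple $\mathrm u_q$-module generated by a highest weight vector $w_0\neq0$ with $x_1w_0=x_2w_0=0$, $\kappa_1w_0=q^nw_0$, $\kappa_2w_0=q^{n+1}w_0$; it has dimension $4$ and quantum dimension zero. The invariant: given an oriented link $\mathcal L$, cut a diagram of $\mathcal L$ at one strand to obtain a tangle $r_{\mathcal L}$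 with one incoming and one outgoing strand. Let $F_W$ be the Reshetikhin–Turaev functor from (framed) oriented tangles to finite-dimensional $\mathrm u_q$-modules determined by $W$. Then $F_W(r_{\mathcal L})\in\mathrm{End}_{\mathrm u_q}(W)=\Bbbk\,\mathrm{id}_W$, and $\mathrm I_W(\mathcal L)\in\Bbbk$ is the scalar with $F_W(r_{\mathcal L})=\mathrm I_W(\mathcal L)\,\mathrm{id}_W$ (independent of the choice of cut). $\mathcal T_{2,-b}$ is the closure of the two-strand braid which $F_W$ sends to $\Psi_{W,W}^{\,b}$, all strands oriented in parallel; thus $\mathrm I_W(\mathcal T_{2,-b})$ is the scalar by which the partial quantum trace of $\Psi_{W,W}^{\,b}$ over the second tensor factor acts on $W$.
   Formalization: The invariant is normalised to framing zero: the scalar of the partial quantum trace of Ψ^b is divided by θ_W^b, where θ_W = −1; without this the scalar is −(b+2Σ(b−i)q^{−i}), so the stated formula fails for odd b. *)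

theory Defs
  imports
    "HOL-Analysis.Analysis"
    "HOL-Library.Poly_Mapping"
    "HOL-Computational_Algebra.Polynomial"
    "HOL-Algebra.QuotRing"
begin

section \<open>The algebra \<open>u\<^sub>q\<close>\<close>

datatype gen = GX1 | GX2 | GY1 | GY2 | GK1 | GK2

datatype word = Word (letters: "gen list")

instantiation word :: monoid_add
begin

definition zero_word :: word where "zero_word = Word []"

definition plus_word :: "word \<Rightarrow> word \<Rightarrow> word"
  where "plus_word v w = Word (letters v @ letters w)"

instance
  by standard (simp_all add: zero_word_def plus_word_def)

end

text \<open>
  The free associative algebra on the six generators is the monoid algebra of the free monoid
  \<^typ>\<open>word\<close>; its multiplication is the convolution product of \<^theory>\<open>HOL-Library.Poly_Mapping\<close>.
\<close>

type_synonym 'k falg = "word \<Rightarrow>\<^sub>0 'k"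

definition cst :: "'k::comm_ring_1 \<Rightarrow> 'k falg"
  where "cst c = Poly_Mapping.single 0 c"

definition gen :: "gen \<Rightarrow> 'k::comm_ring_1 falg"
  where "gen g = Poly_Mapping.single (Word [g]) 1"

abbreviation "X1 \<equiv> gen GX1"
abbreviation "X2 \<equiv> gen GX2"
abbreviation "Y1 \<equiv> gen GY1"
abbreviation "Y2 \<equiv> gen GY2"
abbreviation "K1 \<equiv> gen GK1"
abbreviation "K2 \<equiv> gen GK2"

text \<open>Throughout, \<open>N = 2 * n\<close> is the order of \<open>q\<close>. A relation \<open>l = r\<close> is recorded as \<open>l - r\<close>.\<close>

definition uq_relators :: "nat \<Rightarrow> 'k::field \<Rightarrow> 'k falg set"
  where "uq_relators n q =
   {K1 * K2 - K2 * K1, K1 ^ (2 * n) - 1, K2 ^ (2 * n) - 1,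
    K1 * X1 - cst q * X1 * K1, K1 * X2 - X2 * K1,
    K2 * X1 - X1 * K2, K2 * X2 - cst q * X2 * K2,
    K1 * Y1 - cst (inverse q) * Y1 * K1, K1 * Y2 - Y2 * K1,
    K2 * Y1 - Y1 * K2, K2 * Y2 - cst (inverse q) * Y2 * K2,
    X1 ^ 2, X2 ^ 2, (X1 * X2) ^ (2 * n) + (X2 * X1) ^ (2 * n),
    Y1 ^ 2, Y2 ^ 2, (Y1 * Y2) ^ (2 * n) + (Y2 * Y1) ^ (2 * n),
    Y1 * X1 + X1 * Y1 - (1 - K2), Y2 * X2 + X2 * Y2 - (1 - K1),
    Y2 * X1 - cst q * X1 * Y2, Y1 * X2 - X2 * Y1}"

definition free_ring :: "('k::field falg) ring"
  where "free_ring = \<lparr>carrier = UNIV, monoid.mult = (*), one = 1, zero = 0, add = (+)\<rparr>"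

definition uq_ideal :: "nat \<Rightarrow> 'k::field \<Rightarrow> 'k falg set"
  where "uq_ideal n q = genideal free_ring (uq_relators n q)"

definition uq :: "nat \<Rightarrow> 'k::field \<Rightarrow> ('k falg set) ring"
  where "uq n q = FactRing free_ring (uq_ideal n q)"

definition uq_class :: "nat \<Rightarrow> 'k::field \<Rightarrow> 'k falg \<Rightarrow> 'k falg set"
  where "uq_class n q p = a_r_coset free_ring (uq_ideal n q) p"

text \<open>
  From \<open>\<Delta>(\<kappa>) = \<kappa> \<otimes> \<kappa>\<close> and \<open>\<Delta>(x) = x \<otimes> 1 + g \<otimes> x\<close> one gets \<open>S(\<kappa>) = \<kappa>\<^sup>-\<^sup>1\<close> and \<open>S(x) = - g\<^sup>-\<^sup>1 x\<close>,
  where \<open>g = \<kappa>\<^sub>1\<^sup>n \<kappa>\<^sub>2, \<kappa>\<^sub>2\<^sup>n, \<kappa>\<^sub>1\<^sup>n, \<kappa>\<^sub>1 \<kappa>\<^sub>2\<^sup>n\<close> for \<open>x = x\<^sub>1, x\<^sub>2, y\<^sub>1, y\<^sub>2\<close>. The antipode of \<open>u\<^sub>q\<close> is induced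
  by the following anti-endomorphism of the free algebra.
\<close>

definition K1_inv :: "nat \<Rightarrow> 'k::field falg" where "K1_inv n = K1 ^ (2 * n - 1)"
definition K2_inv :: "nat \<Rightarrow> 'k::field falg" where "K2_inv n = K2 ^ (2 * n - 1)"

primrec antipode_gen :: "nat \<Rightarrow> gen \<Rightarrow> 'k::field falg"
  where
    "antipode_gen n GX1 = - (K1_inv n ^ n * K2_inv n * X1)"
  | "antipode_gen n GX2 = - (K2_inv n ^ n * X2)"
  | "antipode_gen n GY1 = - (K1_inv n ^ n * Y1)"
  | "antipode_gen n GY2 = - (K1_inv n * K2_inv n ^ n * Y2)"
  | "antipode_gen n GK1 = K1_inv n"
  | "antipode_gen n GK2 = K2_inv n"

definition antipode :: "nat \<Rightarrow> 'k::field falg \<Rightarrow> 'k falg"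
  where "antipode n p =
    (\<Sum>w\<in>Poly_Mapping.keys p.
      cst (Poly_Mapping.lookup p w) * prod_list (map (antipode_gen n) (rev (letters w))))"


section \<open>The universal \<open>R\<close>-matrix\<close>

definition y12 :: "'k::field \<Rightarrow> 'k falg"
  where "y12 q = Y1 * Y2 - cst q * Y2 * Y1"

definition x21 :: "'k::field falg"
  where "x21 = X2 * X1 - X1 * X2"

definition qnum :: "'k::field \<Rightarrow> nat \<Rightarrow> 'k"
  where "qnum q m = (\<Sum>i<m. q ^ i)"

definition qfact :: "'k::field \<Rightarrow> nat \<Rightarrow> 'k"
  where "qfact q m = (\<Prod>j=1..m. qnum q j)"

definition y12_div :: "'k::field \<Rightarrow> nat \<Rightarrow> 'k falg"
  where "y12_div q m = cst (inverse ((1 - q) ^ m * qfact q m)) * y12 q ^ m"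

text \<open>
  Since \<open>\<kappa>\<^sub>1, \<kappa>\<^sub>2\<close> commute and \<open>\<kappa>\<^sub>i\<^sup>N = 1\<close>, the projection onto the joint eigenspace \<open>\<kappa>\<^sub>1 = q\<^sup>i\<close>,
  \<open>\<kappa>\<^sub>2 = q\<^sup>j\<close> is \<open>N\<^sup>-\<^sup>2 \<Sum>\<^sub>a\<^sub>,\<^sub>b q\<^sup>-\<^sup>i\<^sup>a\<^sup>-\<^sup>j\<^sup>b \<kappa>\<^sub>1\<^sup>a \<kappa>\<^sub>2\<^sup>b\<close>.
\<close>

definition weight_idem :: "nat \<Rightarrow> 'k::field \<Rightarrow> nat \<Rightarrow> nat \<Rightarrow> 'k falg"
  where "weight_idem n q i j =
    cst (inverse (of_nat (2 * n) ^ 2)) *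
      (\<Sum>a<2 * n. \<Sum>b<2 * n. cst (inverse q ^ (i * a + j * b)) * K1 ^ a * K2 ^ b)"

text \<open>
  \<open>R\<close> is the sum over \<open>t = (b\<^sub>1, b\<^sub>2, b, i\<^sub>1, i\<^sub>2) \<in> R_index n\<close> of \<open>R_left n q t \<otimes> R_right n q t\<close>.
\<close>

definition R_index :: "nat \<Rightarrow> (nat \<times> nat \<times> nat \<times> nat \<times> nat) set"
  where "R_index n = {0, 1} \<times> {0, 1} \<times> {..<2 * n} \<times> {..<2 * n} \<times> {..<2 * n}"

definition R_left :: "nat \<Rightarrow> 'k::field \<Rightarrow> nat \<times> nat \<times> nat \<times> nat \<times> nat \<Rightarrow> 'k falg"
  where "R_left n q = (\<lambda>(b1, b2, b, i1, i2).
    K1 ^ (n * i1 + i2) * K2 ^ (n * i2) * Y2 ^ b2 * y12_div q b * Y1 ^ b1)"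

definition R_right :: "nat \<Rightarrow> 'k::field \<Rightarrow> nat \<times> nat \<times> nat \<times> nat \<times> nat \<Rightarrow> 'k falg"
  where "R_right n q = (\<lambda>(b1, b2, b, i1, i2).
    X1 ^ b1 * x21 ^ b * X2 ^ b2 * weight_idem n q i1 i2)"

definition pivot :: "nat \<Rightarrow> 'k::field falg"
  where "pivot n = K1 ^ n * K2 ^ n"

definition drinfeld_u :: "nat \<Rightarrow> 'k::field \<Rightarrow> 'k falg"
  where "drinfeld_u n q = (\<Sum>t\<in>R_index n. antipode n (R_right n q t) * R_left n q t)"


section \<open>Modules\<close>

text \<open>
  A finite-dimensional \<open>u\<^sub>q\<close>-module is given in coordinates, by a homomorphism of unital
  algebras from \<open>u\<^sub>q\<close> to the square matrices indexed by a finite type.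
\<close>

definition mat_ring :: "('k::field ^ 'd ^ 'd) ring"
  where "mat_ring = \<lparr>carrier = UNIV, monoid.mult = (**), one = mat 1, zero = 0, add = (+)\<rparr>"

definition uq_module :: "nat \<Rightarrow> 'k::field \<Rightarrow> ('k falg set \<Rightarrow> 'k ^ 'd ^ 'd) \<Rightarrow> bool"
  where "uq_module n q \<phi> \<longleftrightarrow>
    \<phi> \<in> ring_hom (uq n q) mat_ring \<and> (\<forall>c. \<phi> (uq_class n q (cst c)) = mat c)"

definition act :: "nat \<Rightarrow> 'k::field \<Rightarrow> ('k falg set \<Rightarrow> 'k ^ 'd ^ 'd) \<Rightarrow> 'k falg \<Rightarrow> 'k ^ 'd ^ 'd"
  where "act n q \<phi> p = \<phi> (uq_class n q p)"

definition simple_uq_module :: "nat \<Rightarrow> 'k::field \<Rightarrow> ('k falg set \<Rightarrow> 'k ^ 'd ^ 'd) \<Rightarrow> bool"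
  where "simple_uq_module n q \<phi> \<longleftrightarrow>
    uq_module n q \<phi> \<and>
    (\<forall>U. vec.subspace U \<and> (\<forall>p. \<forall>v\<in>U. act n q \<phi> p *v v \<in> U) \<longrightarrow> U = {0} \<or> U = UNIV)"

text \<open>
  \<open>is_L n q r s \<phi>\<close>: the module \<open>\<phi>\<close> is (a model of) \<open>L(r, s)\<close>. By simplicity the nonzero vector \<open>w\<close>
  generates the module.
\<close>

definition is_L ::
    "nat \<Rightarrow> 'k::field \<Rightarrow> nat \<Rightarrow> nat \<Rightarrow> ('k falg set \<Rightarrow> 'k ^ 'd ^ 'd) \<Rightarrow> bool"
  where "is_L n q r s \<phi> \<longleftrightarrow>
    simple_uq_module n q \<phi> \<and>
    (\<exists>w. w \<noteq> 0 \<and> act n q \<phi> X1 *v w = 0 \<and> act n q \<phi> X2 *v w = 0 \<and>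
         act n q \<phi> K1 *v w = q ^ r *s w \<and> act n q \<phi> K2 *v w = q ^ s *s w)"

text \<open>
  Matrix of \<open>\<Psi>(v \<otimes> v') = R\<^sup>(\<^sup>2\<^sup>) v' \<otimes> R\<^sup>(\<^sup>1\<^sup>) v\<close> in the basis \<open>e\<^sub>i \<otimes> e\<^sub>j\<close>: the entry at row \<open>(i, j)\<close> and
  column \<open>(k, l)\<close> is the coefficient of \<open>e\<^sub>i \<otimes> e\<^sub>j\<close> in \<open>\<Psi>(e\<^sub>k \<otimes> e\<^sub>l)\<close>.
\<close>

definition braiding ::
    "nat \<Rightarrow> 'k::field \<Rightarrow> ('k falg set \<Rightarrow> 'k ^ 'd ^ 'd) \<Rightarrow> 'k ^ ('d \<times> 'd) ^ ('d::finite \<times> 'd)"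
  where "braiding n q \<phi> = (\<chi> io kl.
    \<Sum>t\<in>R_index n.
      act n q \<phi> (R_right n q t) $ fst io $ snd kl * act n q \<phi> (R_left n q t) $ snd io $ fst kl)"

definition twist ::
    "nat \<Rightarrow> 'k::field \<Rightarrow> ('k falg set \<Rightarrow> 'k ^ 'd ^ 'd) \<Rightarrow> 'k ^ 'd ^ 'd"
  where "twist n q \<phi> = act n q \<phi> (pivot n) ** matrix_inv (act n q \<phi> (drinfeld_u n q))"


section \<open>Oriented tangle diagrams and the Reshetikhin--Turaev functor\<close>

text \<open>
  Diagrams of oriented tangles, with blackboard framing, are built from strands, the two crossings
  of parallel strands and the four oriented cups and caps by composition and juxtaposition.
  \<open>Comp S T\<close> is \<open>S\<close> after \<open>T\<close>. \<open>Cross\<close> is the crossing sent to \<open>\<Psi>\<close>.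
\<close>

datatype orient = Up | Down

datatype tangle =
    Strand orient
  | Cross | CrossInv
  | Coev | Ev | CoevR | EvR
  | Comp tangle tangle
  | Tens tangle tangle

primrec src :: "tangle \<Rightarrow> orient list"
  where
    "src (Strand s) = [s]"
  | "src Cross = [Up, Up]"
  | "src CrossInv = [Up, Up]"
  | "src Coev = []"
  | "src Ev = [Down, Up]"
  | "src CoevR = []"
  | "src EvR = [Up, Down]"
  | "src (Comp S T) = src T"
  | "src (Tens S T) = src S @ src T"

primrec tgt :: "tangle \<Rightarrow> orient list"
  where
    "tgt (Strand s) = [s]"
  | "tgt Cross = [Up, Up]"
  | "tgt CrossInv = [Up, Up]"
  | "tgt Coev = [Up, Down]"
  | "tgt Ev = []"
  | "tgt CoevR = [Down, Up]"
  | "tgt EvR = []"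
  | "tgt (Comp S T) = tgt S"
  | "tgt (Tens S T) = tgt S @ tgt T"

primrec composable :: "tangle \<Rightarrow> bool"
  where
    "composable (Strand s) = True"
  | "composable Cross = True"
  | "composable CrossInv = True"
  | "composable Coev = True"
  | "composable Ev = True"
  | "composable CoevR = True"
  | "composable EvR = True"
  | "composable (Comp S T) = (composable S \<and> composable T \<and> src S = tgt T)"
  | "composable (Tens S T) = (composable S \<and> composable T)"

text \<open>The writhe, counted so that \<open>Cross\<close> is positive.\<close>

primrec writhe :: "tangle \<Rightarrow> int"
  where
    "writhe (Strand s) = 0"
  | "writhe Cross = 1"
  | "writhe CrossInv = - 1"
  | "writhe Coev = 0"
  | "writhe Ev = 0"
  | "writhe CoevR = 0"
  | "writhe EvR = 0"
  | "writhe (Comp S T) = writhe S + writhe T"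
  | "writhe (Tens S T) = writhe S + writhe T"

text \<open>
  \<open>F_W\<close> sends a word of orientations to the tensor product of copies of \<open>W\<close> (for \<open>Up\<close>) and \<open>W\<^sup>*\<close>
  (for \<open>Down\<close>), with the tensor basis labelled by lists of basis labels. \<open>RT n q \<phi> T o i\<close> is the matrix
  entry of \<open>F_W(T)\<close> in row \<open>o\<close> (of length \<open>length (tgt T)\<close>) and column \<open>i\<close> (of length
  \<open>length (src T)\<close>). \<open>Coev\<close> and \<open>Ev\<close> are the coevaluation \<open>1 \<mapsto> \<Sum> e\<^sub>i \<otimes> e\<^sub>i\<^sup>*\<close> and the evaluation
  \<open>f \<otimes> v \<mapsto> f(v)\<close>; \<open>CoevR\<close> and \<open>EvR\<close> are those for the other duality, given by the pivotal
  structure: \<open>1 \<mapsto> \<Sum> e\<^sub>i\<^sup>* \<otimes> \<nu>\<^sup>-\<^sup>1 e\<^sub>i\<close> and \<open>v \<otimes> f \<mapsto> f(\<nu> v)\<close>.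
\<close>

primrec RT ::
    "nat \<Rightarrow> 'k::field \<Rightarrow> ('k falg set \<Rightarrow> 'k ^ 'd ^ 'd) \<Rightarrow> tangle \<Rightarrow>
     ('d::finite) list \<Rightarrow> 'd list \<Rightarrow> 'k"
  where
    "RT n q \<phi> (Strand s) = (\<lambda>out inp. if out = inp then 1 else 0)"
  | "RT n q \<phi> Cross = (\<lambda>out inp. braiding n q \<phi> $ (out ! 0, out ! 1) $ (inp ! 0, inp ! 1))"
  | "RT n q \<phi> CrossInv =
      (\<lambda>out inp. matrix_inv (braiding n q \<phi>) $ (out ! 0, out ! 1) $ (inp ! 0, inp ! 1))"
  | "RT n q \<phi> Coev = (\<lambda>out inp. if out ! 0 = out ! 1 then 1 else 0)"
  | "RT n q \<phi> Ev = (\<lambda>out inp. if inp ! 0 = inp ! 1 then 1 else 0)"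
  | "RT n q \<phi> CoevR = (\<lambda>out inp. matrix_inv (act n q \<phi> (pivot n)) $ (out ! 1) $ (out ! 0))"
  | "RT n q \<phi> EvR = (\<lambda>out inp. act n q \<phi> (pivot n) $ (inp ! 1) $ (inp ! 0))"
  | "RT n q \<phi> (Comp S T) = (\<lambda>out inp.
      \<Sum>m\<in>{m. length m = length (tgt T)}. RT n q \<phi> S out m * RT n q \<phi> T m inp)"
  | "RT n q \<phi> (Tens S T) = (\<lambda>out inp.
      RT n q \<phi> S (take (length (tgt S)) out) (take (length (src S)) inp) *
      RT n q \<phi> T (drop (length (tgt S)) out) (drop (length (src S)) inp))"

text \<open>
  A diagram \<open>T\<close> with one incoming and one outgoing strand carries its blackboard framing. The
  twist acts on \<open>W\<close> by a scalar \<open>\<theta>\<close>, a change of framing by one full twist multiplies \<open>F_W(T)\<close> by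
  \<open>\<theta>\<close>, and a curl made of \<open>Cross\<close> is sent to \<open>\<theta>\<close> itself. The invariant of the underlying
  unframed link is therefore the scalar \<open>c\<close> such that \<open>F_W(T) = c \<theta>\<^sup>w id\<close>, where \<open>w\<close> is the writhe;
  for a diagram with \<open>w = 0\<close>, and for any diagram if \<open>\<theta> = 1\<close>, this is \<open>F_W(T) = c id\<close>.
  For \<open>W = L(n, n + 1)\<close> one has \<open>\<theta> = - 1\<close> when \<open>n\<close> is even.
\<close>

definition is_link_scalar ::
    "nat \<Rightarrow> 'k::field \<Rightarrow> ('k falg set \<Rightarrow> 'k ^ 'd ^ 'd::finite) \<Rightarrow> tangle \<Rightarrow> 'k \<Rightarrow> bool"
  where "is_link_scalar n q \<phi> T c \<longleftrightarrow>
    composable T \<and> src T = [Up] \<and> tgt T = [Up] \<and>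
    (\<exists>\<theta>. \<theta> \<noteq> 0 \<and> twist n q \<phi> = mat \<theta> \<and>
         (\<forall>i j. RT n q \<phi> T [i] [j] = mat (c * \<theta> powi writhe T) $ i $ j))"

definition link_invariant ::
    "nat \<Rightarrow> 'k::field \<Rightarrow> ('k falg set \<Rightarrow> 'k ^ 'd ^ 'd::finite) \<Rightarrow> tangle \<Rightarrow> 'k"
  where "link_invariant n q \<phi> T = (THE c. is_link_scalar n q \<phi> T c)"

primrec cross_pow :: "nat \<Rightarrow> tangle"
  where
    "cross_pow 0 = Tens (Strand Up) (Strand Up)"
  | "cross_pow (Suc b) = Comp Cross (cross_pow b)"

text \<open>
  The closure of the two-strand braid with \<open>b\<close> crossings, cut open at its first strand, that is,
  with only the second strand closed up (on the right).
\<close>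

definition torus_cut :: "nat \<Rightarrow> tangle"
  where "torus_cut b =
    Comp (Tens (Strand Up) EvR)
      (Comp (Tens (cross_pow b) (Strand Down))
        (Tens (Strand Up) Coev))"

definition primitive_root_of_unity :: "nat \<Rightarrow> 'k::field \<Rightarrow> bool"
  where "primitive_root_of_unity N q \<longleftrightarrow>
    N > 0 \<and> q ^ N = 1 \<and> (\<forall>k. 0 < k \<and> k < N \<longrightarrow> q ^ k \<noteq> 1)"

end

(*
  W has a basis e0 = w, e1 = y1 w, e2 = y2 w, e3 = y1 y2 w on which the generators act monomially:
  y2 y1 w and y1 y2 w are proportional because a combination of them is singular and the y-words are
  nilpotent. Only five terms of the R-matrix survive on W, so the braiding preserves the spans of
  the vectors e_i (x) e_j of equal weight, which have dimension at most four, and its powers there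
  have closed forms in p = 1/q by induction. The partial trace of the b-th power is minus the
  polynomial of the theorem, and the twist acts by -1, which turns this into the sign (-1)^(b+1).
*)
theory Submission
  imports Defs
begin

section \<open>The free algebra and the antipode\<close>

text \<open>The index type of the matrices is arbitrary, so neither dimension four nor an adapted
  basis is available beforehand. Calculations therefore take place on vectors, and only at the end
  is the trace over coordinates carried to \<open>e0\<close>, ..., \<open>e3\<close> through dual
  functionals. The weight (n, n + 1) is special because q^n = -1: on \<open>w\<close> the two torus
  generators act by -1 and -q, and exactly then one multiple of \<open>e3\<close> cancels
  \<open>A Y2 e1\<close> under both \<open>X1\<close> and \<open>X2\<close>, so the module collapses
  to four dimensions. On the weight blocks the braiding has only the eigenvalues 1 and
  \<open>p\<close>, with Jordan blocks of size at most two for 1. Entries of its b-th power are thus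
  combinations of 1, b and p^b, which is how a polynomial mixing linear growth with geometric sums
  arises. The pivot acts on the basis by the signs -1, 1, 1, -1; for b = 0 the partial trace is
  zero, in accordance with quantum dimension zero.\<close>

lemma cst_add: "cst (a + b) = cst a + cst b"
  by (simp add: cst_def single_add)

lemma cst_mult: "cst (a * b) = cst a * cst b"
  by (simp add: cst_def mult_single)

lemma cst_0 [simp]: "cst 0 = 0"
  by (simp add: cst_def)

lemma cst_1 [simp]: "cst 1 = 1"
  by (simp add: cst_def)

lemma single_Word: "Poly_Mapping.single (Word ws) c = cst c * prod_list (map gen ws)"
proof (induction ws)
  case Nil
  then show ?case
    by (simp add: cst_def zero_word_def)
next
  case (Cons w ws)
  have *: "prod_list (map gen ws) = Poly_Mapping.single (Word ws) (1 :: 'a)" for ws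
  proof (induction ws)
    case Nil
    then show ?case by (simp flip: zero_word_def)
  next
    case (Cons a ws)
    then show ?case by (simp add: gen_def mult_single plus_word_def)
  qed
  show ?case
    unfolding * cst_def by (simp add: mult_single)
qed

lemma falg_single_induct [case_names zero add]:
  fixes p :: "'k::field falg"
  assumes "P 0" "\<And>w c p. P p \<Longrightarrow> P (Poly_Mapping.single w c + p)"
  shows "P p"
proof (induction p rule: update_induct)
  case const
  show ?case using assms by simp
next
  case (update f a b)
  have "Poly_Mapping.update a b f = Poly_Mapping.single a b + f"
    using update(1) by (intro poly_mapping_eqI)
      (auto simp: lookup_update lookup_add lookup_single when_def in_keys_iff)
  then show ?case
    using assms update by simp
qed

text \<open>Monomials are products of generators, so these four cases exhaust the free algebra. This
  reduces centrality of scalars and stability of subspaces to the six generators.\<close>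

lemma falg_induct [case_names cst gen add mult]:
  fixes p :: "'k::field falg"
  assumes cst: "\<And>c. P (cst c)" and gen: "\<And>g. P (gen g)"
    and add: "\<And>p q. P p \<Longrightarrow> P q \<Longrightarrow> P (p + q)"
    and mult: "\<And>p q. P p \<Longrightarrow> P q \<Longrightarrow> P (p * q)"
  shows "P p"
proof (induction p rule: falg_single_induct)
  case zero
  show ?case using cst[of 0] by simp
next
  case (add w c p)
  have "P (prod_list (map gen ws))" for ws
    by (induction ws) (use gen mult cst[of 1] in auto)
  then have "P (Poly_Mapping.single w c)"
    using single_Word[of "letters w" c] mult cst by simp
  then show ?case
    using assms(3) add by simp
qed

lemma cst_commute: "cst c * p = p * cst (c :: 'k::field)"
proof (induction p rule: falg_induct)
  case (cst d)
  then show ?case by (simp add: mult.commute flip: cst_mult)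
next
  case (gen g)
  then show ?case by (simp add: cst_def gen_def mult_single)
next
  case (add p q)
  then show ?case by (simp add: algebra_simps)
next
  case (mult p q)
  then show ?case by (metis mult.assoc)
qed

definition antipode_word :: "nat \<Rightarrow> word \<Rightarrow> 'k::field falg"
  where "antipode_word n w = prod_list (map (antipode_gen n) (rev (letters w)))"

text \<open>A common finite index set serves several elements at once, even where cancellation
  shrinks the support of their sum.\<close>

lemma antipode_superset:
  assumes "finite S" "Poly_Mapping.keys p \<subseteq> S"
  shows "antipode n p = (\<Sum>w\<in>S. cst (Poly_Mapping.lookup p w) * antipode_word n w)"
  unfolding antipode_def antipode_word_def
  by (rule sum.mono_neutral_left) (use assms in \<open>auto simp: in_keys_iff\<close>)

lemma antipode_add: "antipode n (p + q) = antipode n p + antipode n q"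
proof -
  let ?S = "Poly_Mapping.keys p \<union> Poly_Mapping.keys q"
  have "finite ?S" "Poly_Mapping.keys (p + q) \<subseteq> ?S"
    by (auto simp: keys_add)
  then show ?thesis
    by (simp add: antipode_superset[of ?S] lookup_add cst_add distrib_right sum.distrib)
qed

lemma antipode_single: "antipode n (Poly_Mapping.single w c) = cst c * antipode_word n w"
  by (simp add: antipode_superset[of "{w}"])

lemma antipode_cst [simp]: "antipode n (cst c) = cst c"
  by (simp add: cst_def antipode_single antipode_word_def zero_word_def)

lemma antipode_gen [simp]: "antipode n (gen g) = antipode_gen n g"
  by (simp add: gen_def antipode_single antipode_word_def)

lemma antipode_single_mult:
  "antipode n (Poly_Mapping.single v c * Poly_Mapping.single w d) =
    antipode n (Poly_Mapping.single w d) * antipode n (Poly_Mapping.single v c)"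
proof -
  have "antipode_word n (v + w) = (antipode_word n w * antipode_word n v :: 'a falg)"
    by (simp add: antipode_word_def plus_word_def)
  then show ?thesis
    by (simp add: mult_single antipode_single cst_mult) (metis cst_commute mult.assoc)
qed

lemma antipode_0 [simp]: "antipode n 0 = 0"
  by (simp add: antipode_def)

text \<open>Both sides are biadditive, so monomials suffice; there, reversing a concatenation
  exchanges its two parts, and scalars are central.\<close>

lemma antipode_mult: "antipode n (p * q) = antipode n q * antipode n p"
proof (induction p rule: falg_single_induct)
  case (add v c p)
  have "antipode n (Poly_Mapping.single v c * q) =
    antipode n q * antipode n (Poly_Mapping.single v c)"
    by (induction q rule: falg_single_induct)
      (simp_all add: antipode_add antipode_single_mult algebra_simps)
  with add show ?case
    by (simp add: antipode_add algebra_simps)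
qed simp

lemma antipode_1 [simp]: "antipode n 1 = 1"
  using antipode_cst[of n 1] by simp

lemma antipode_power: "antipode n (p ^ k) = antipode n p ^ k"
  by (induction k) (simp_all add: antipode_mult power_commutes)

lemma antipode_minus: "antipode n (- p) = - antipode n p"
  using antipode_add[of n p "- p"] by (simp add: eq_neg_iff_add_eq_0 add.commute)

lemma antipode_diff: "antipode n (p - q) = antipode n p - antipode n q"
  using antipode_add[of n p "- q"] by (simp add: antipode_minus)

lemma antipode_sum: "antipode n (\<Sum>i\<in>S. f i) = (\<Sum>i\<in>S. antipode n (f i))"
  by (induction S rule: infinite_finite_induct) (simp_all add: antipode_add)

section \<open>Representations of \<open>u\<^sub>q\<close>\<close>

lemma ring_free_ring: "ring (free_ring :: 'k::field falg ring)"
proof (rule ringI)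
  show "abelian_group (free_ring :: 'k falg ring)"
    by (rule abelian_groupI) (auto simp: free_ring_def algebra_simps intro: exI[of _ "- _"])
  show "monoid (free_ring :: 'k falg ring)"
    by (rule monoidI) (auto simp: free_ring_def algebra_simps)
qed (auto simp: free_ring_def algebra_simps)

lemma ideal_uq_ideal: "ideal (uq_ideal n q) free_ring"
  unfolding uq_ideal_def by (rule ring.genideal_ideal[OF ring_free_ring]) (simp add: free_ring_def)

lemma uq_class_hom: "uq_class n q \<in> ring_hom free_ring (uq n q)"
  using ideal.rcos_ring_hom[OF ideal_uq_ideal] by (simp add: uq_class_def [abs_def] uq_def)

lemma uq_class_eq_0:
  assumes "p \<in> uq_relators n q"
  shows "uq_class n q p = uq_class n q 0"
proof -
  interpret ideal "uq_ideal n q" free_ring by (rule ideal_uq_ideal)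
  have "p \<in> uq_ideal n q"
    unfolding uq_ideal_def using assms
    by (intro set_mp[OF ring.genideal_self[OF ring_free_ring]]) (auto simp: free_ring_def)
  moreover have "0 \<in> uq_ideal n q"
    using additive_subgroup.zero_closed[of "uq_ideal n q" free_ring] additive_subgroup_axioms
    by (simp add: free_ring_def)
  ultimately show ?thesis
    unfolding uq_class_def by (metis a_rcos_const)
qed

lemma mat_mult_vec [simp]: "mat c *v v = (c :: 'k::comm_ring_1) *s v"
  by (simp add: vec_eq_iff matrix_vector_mult_def mat_def
      if_distrib [where f = "\<lambda>x. x * _"] cong: if_cong)

locale uq_mod =
  fixes n :: nat and q :: "'k::{field, field_char_0}" and \<phi> :: "'k falg set \<Rightarrow> 'k ^ 'd ^ 'd"
  assumes uq_module: "uq_module n q \<phi>"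
begin

abbreviation A :: "'k falg \<Rightarrow> 'k ^ 'd \<Rightarrow> 'k ^ 'd"
  where "A p v \<equiv> act n q \<phi> p *v v"

text \<open>Pulling the representation back along the quotient map replaces cosets by elements of
  the free algebra; the relations then enter only through \<open>A_relator\<close>.\<close>

lemma act_hom: "act n q \<phi> \<in> ring_hom free_ring mat_ring"
proof -
  have "act n q \<phi> = \<phi> \<circ> uq_class n q"
    by (auto simp: act_def)
  then show ?thesis
    using ring_hom_trans[OF uq_class_hom] uq_module unfolding uq_module_def by metis
qed

lemma act_mult: "act n q \<phi> (r * s) = act n q \<phi> r ** act n q \<phi> s"
  using ring_hom_mult[OF act_hom, of r s] by (simp add: free_ring_def mat_ring_def)

lemma act_add: "act n q \<phi> (r + s) = act n q \<phi> r + act n q \<phi> s"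
  using ring_hom_add[OF act_hom, of r s] by (simp add: free_ring_def mat_ring_def)

lemma A_cst [simp]: "A (cst c) v = c *s v"
  using uq_module by (simp add: act_def uq_module_def)

lemma A_mult [simp]: "A (r * s) v = A r (A s v)"
  by (simp add: act_mult matrix_vector_mul_assoc)

lemma A_add [simp]: "A (r + s) v = A r v + A s v"
  by (simp add: act_add algebra_simps)

lemma A_0 [simp]: "A 0 v = 0" and A_1 [simp]: "A 1 v = v"
  using A_cst[of 0 v] A_cst[of 1 v] by (simp_all del: A_cst)

lemma A_minus [simp]: "A (- r) v = - A r v"
  using A_add[of r "- r" v] by (simp del: A_add add: eq_neg_iff_add_eq_0 add.commute)

lemma A_diff [simp]: "A (r - s) v = A r v - A s v"
  using A_add[of r "- s" v] by simp

lemma A_sum [simp]: "A (\<Sum>i\<in>S. f i) v = (\<Sum>i\<in>S. A (f i) v)"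
  by (induction S rule: infinite_finite_induct) simp_all

lemma A_scale [simp]: "A r (c *s v) = c *s A r v"
  by (rule vec.scale)

lemma A_vadd [simp]: "A r (v + w) = A r v + A r w"
  by (rule vec.add)

lemma A_vdiff [simp]: "A r (v - w) = A r v - A r w"
  by (rule vec.diff)

lemma A_vneg [simp]: "A r (- w) = - A r w"
  by (rule vec.neg)

lemma A_power_eigen: "A r v = c *s v \<Longrightarrow> A (r ^ k) v = c ^ k *s v"
  by (induction k) (simp_all add: mult.commute)

lemma A_relator: "r \<in> uq_relators n q \<Longrightarrow> A r v = 0"
  using uq_class_eq_0[of r n q] A_0[of v] by (simp add: act_def)

lemma invariant:
  assumes U: "vec.subspace U" and "\<And>g v. v \<in> U \<Longrightarrow> A (gen g) v \<in> U" and "v \<in> U"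
  shows "A r v \<in> U"
  using \<open>v \<in> U\<close>
  by (induction r arbitrary: v rule: falg_induct)
    (use assms(1,2) in \<open>auto intro: vec.subspace_scale vec.subspace_add\<close>)

section \<open>The defining relations as rewriting rules on vectors\<close>

lemma Y_Y [simp]: "A Y1 (A Y1 v) = 0" "A Y2 (A Y2 v) = 0"
  using A_relator[of "Y1 ^ 2" v] A_relator[of "Y2 ^ 2" v]
  by (simp_all add: uq_relators_def power2_eq_square)

text \<open>Oriented so that torus generators, and likewise \<open>X1\<close> and \<open>X2\<close>
  in the rules below, travel inward past \<open>Y1\<close> and \<open>Y2\<close> until they reach a
  highest weight vector.\<close>

lemma K_Y:
  "A K1 (A Y1 v) = inverse q *s A Y1 (A K1 v)" "A K1 (A Y2 v) = A Y2 (A K1 v)"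
  "A K2 (A Y1 v) = A Y1 (A K2 v)" "A K2 (A Y2 v) = inverse q *s A Y2 (A K2 v)"
  using A_relator[of "K1 * Y1 - cst (inverse q) * Y1 * K1" v] A_relator[of "K1 * Y2 - Y2 * K1" v]
    A_relator[of "K2 * Y1 - Y1 * K2" v] A_relator[of "K2 * Y2 - cst (inverse q) * Y2 * K2" v]
  by (simp_all add: uq_relators_def)

lemma X_Y:
  "A X1 (A Y1 v) = v - A K2 v - A Y1 (A X1 v)" "A X2 (A Y2 v) = v - A K1 v - A Y2 (A X2 v)"
  "A X2 (A Y1 v) = A Y1 (A X2 v)"
  using A_relator[of "Y1 * X1 + X1 * Y1 - (1 - K2)" v]
    A_relator[of "Y2 * X2 + X2 * Y2 - (1 - K1)" v] A_relator[of "Y1 * X2 - X2 * Y1" v]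
  by (simp_all add: uq_relators_def algebra_simps)

lemma X1_Y2: "q \<noteq> 0 \<Longrightarrow> A X1 (A Y2 v) = inverse q *s A Y2 (A X1 v)"
  using A_relator[of "Y2 * X1 - cst q * X1 * Y2" v] by (simp add: uq_relators_def)

lemma Y_power_swap:
  "A ((Y1 * Y2) ^ (2 * n)) v = - A ((Y2 * Y1) ^ (2 * n)) v"
  using A_relator[of "(Y1 * Y2) ^ (2 * n) + (Y2 * Y1) ^ (2 * n)" v]
  by (simp add: uq_relators_def eq_neg_iff_add_eq_0)

text \<open>Since \<open>Y1\<close> squares to zero, \<open>A Y1 v\<close> depends only on the
  \<open>Y2\<close>-image part of \<open>v\<close>, and symmetrically. Iterating writes
  \<open>A Y1 v\<close> as (Y1 Y2)^(2n) applied to some \<open>A Y1 v'\<close>. The relation between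
  the two alternating words turns that power into -(Y2 Y1)^(2n), whose rightmost \<open>Y1\<close>
  meets another \<open>Y1\<close>. So both images vanish, and with them the whole space.\<close>

lemma Y_image_sum_eq_0:
  assumes n: "n > 0" and gen: "\<And>v. \<exists>a b. v = A Y1 a + A Y2 b"
  shows "(v :: 'k ^ 'd) = 0"
proof -
  have s1: "\<exists>v'. A Y1 v = A Y1 (A Y2 v')" for v
    using gen[of v] by fastforce
  have s2: "\<exists>v'. A Y2 v = A Y2 (A Y1 v')" for v
    using gen[of v] by fastforce
  have p1: "\<exists>v'. A Y1 v = A ((Y1 * Y2) ^ k) (A Y1 v')" for k v
  proof (induction k)
    case (Suc k)
    then obtain v' where "A Y1 v = A ((Y1 * Y2) ^ k) (A Y1 v')" by blast
    moreover obtain v'' where "A Y1 v' = A Y1 (A Y2 v'')" using s1 by blast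
    moreover obtain v3 where "A Y2 v'' = A Y2 (A Y1 v3)" using s2 by blast
    ultimately have "A Y1 v = A ((Y1 * Y2) ^ Suc k) (A Y1 v3)"
      by (simp add: power_Suc2 del: power_Suc)
    then show ?case by blast
  qed auto
  have p2: "\<exists>v'. A Y2 v = A ((Y2 * Y1) ^ k) (A Y2 v')" for k v
  proof (induction k)
    case (Suc k)
    then obtain v' where "A Y2 v = A ((Y2 * Y1) ^ k) (A Y2 v')" by blast
    moreover obtain v'' where "A Y2 v' = A Y2 (A Y1 v'')" using s2 by blast
    moreover obtain v3 where "A Y1 v'' = A Y1 (A Y2 v3)" using s1 by blast
    ultimately have "A Y2 v = A ((Y2 * Y1) ^ Suc k) (A Y2 v3)"
      by (simp add: power_Suc2 del: power_Suc)
    then show ?case by blast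
  qed auto
  obtain m where m: "2 * n = Suc m"
    using n by (cases "2 * n") auto
  have "A Y1 v = 0" for v
    using p1[of v "2 * n"] unfolding Y_power_swap unfolding m
    by (auto simp: power_Suc2 simp del: power_Suc)
  moreover have "A Y2 v = 0" for v
  proof -
    have *: "A ((Y2 * Y1) ^ (2 * n)) v = - A ((Y1 * Y2) ^ (2 * n)) v" for v
      by (simp add: Y_power_swap)
    show ?thesis
      using p2[of v "2 * n"] unfolding * unfolding m
      by (auto simp: power_Suc2 simp del: power_Suc)
  qed
  ultimately show ?thesis
    using gen[of v] by auto
qed

end

locale simple_uq_mod = uq_mod +
  assumes simple: "simple_uq_module n q \<phi>" and n_pos: "n > 0" and q_nz: "q \<noteq> 0"
begin

lemma submodule_cases:
  assumes "vec.subspace U" "\<And>g v. v \<in> U \<Longrightarrow> A (gen g) v \<in> U"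
  shows "U = {0} \<or> U = UNIV"
  using simple invariant[of U] assms unfolding simple_uq_module_def by blast

text \<open>
  The submodule generated by a singular vector \<open>s\<close> consists of the combinations of \<open>y\<close>-words applied
  to \<open>s\<close>. If it were the whole space, the images of \<open>y\<^sub>1\<close> and \<open>y\<^sub>2\<close> would span, which the nilpotency
  of the \<open>y\<close>-words forbids.
\<close>

lemma singular_eq_0:
  assumes X: "A X1 s = 0" "A X2 s = 0" and K: "A K1 s = a *s s" "A K2 s = b *s s"
    and s: "s = A Y1 u1 + A Y2 u2"
  shows "s = 0"
proof -
  define f where "f ws = A (prod_list (map gen ws)) s" for ws
  have f_simps [simp]: "f [] = s" "f (g # ws) = A (gen g) (f ws)" for g ws
    by (simp_all add: f_def)
  define U where "U = vec.span {f ws | ws. set ws \<subseteq> {GY1, GY2}}"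
  have U: "vec.subspace U"
    by (simp add: U_def vec.subspace_span)
  note UI = vec.subspace_add[OF U] vec.subspace_diff[OF U] vec.subspace_scale[OF U]
    vec.subspace_0[OF U]
  have fU: "f ws \<in> U" if "set ws \<subseteq> {GY1, GY2}" for ws
    unfolding U_def using that by (intro vec.span_base) blast
  have ext: "A g v \<in> U"
    if "v \<in> U" and *: "\<And>ws. set ws \<subseteq> {GY1, GY2} \<Longrightarrow> A g (f ws) \<in> U" for g v
    using \<open>v \<in> U\<close>[unfolded U_def]
  proof (induction rule: vec.span_induct)
    case base
    show ?case unfolding vec.subspace_def by (auto intro: UI)
  qed (use * in auto)
  have Y1: "A Y1 v \<in> U" if "v \<in> U" for v
    using ext[OF that, of Y1] fU[of "GY1 # _"] by simp
  have Y2: "A Y2 v \<in> U" if "v \<in> U" for v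
    using ext[OF that, of Y2] fU[of "GY2 # _"] by simp
  have sU: "s \<in> U"
    using fU[of "[]"] by simp
  have Kf: "A K1 (f ws) \<in> U \<and> A K2 (f ws) \<in> U" if "set ws \<subseteq> {GY1, GY2}" for ws
    using that
  proof (induction ws)
    case Nil
    show ?case using K sU by (auto intro: UI)
  next
    case (Cons g ws)
    then show ?case by (auto simp: K_Y intro!: UI Y1 Y2)
  qed
  \<comment> \<open>Moving \<open>X1\<close> or \<open>X2\<close> past the leading letter leaves
    torus terms, covered by \<open>Kf\<close>, and the same operator on a shorter word. Hence the
    span of the y-words is already a submodule.\<close>
  have Xf: "A X1 (f ws) \<in> U \<and> A X2 (f ws) \<in> U" if "set ws \<subseteq> {GY1, GY2}" for ws
    using that
  proof (induction ws)
    case Nil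
    show ?case using X sU by (auto intro: UI)
  next
    case (Cons g ws)
    then show ?case using Kf[of ws] fU[of ws]
      by (auto simp: X_Y X1_Y2[OF q_nz] intro!: UI Y1 Y2)
  qed
  have "A (gen g) v \<in> U" if "v \<in> U" for g v
    using Y1 Y2 ext[OF that] Kf Xf that by (cases g) auto
  then consider "U = {0}" | "U = UNIV"
    using submodule_cases[OF U] by blast
  then show ?thesis
  proof cases
    case 2
    have "\<exists>a b. v = A Y1 a + A Y2 b" for v
    proof -
      have "v \<in> U" using 2 by simp
      then show ?thesis unfolding U_def
      proof (induction rule: vec.span_induct)
        case base
        show ?case unfolding vec.subspace_def
        proof (intro conjI allI ballI)
          show "0 \<in> {v. \<exists>a b. v = A Y1 a + A Y2 b}"
            by (auto intro!: exI[of _ 0])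
          fix x y c
          assume x: "x \<in> {v. \<exists>a b. v = A Y1 a + A Y2 b}"
          then obtain a b where ab: "x = A Y1 a + A Y2 b" by blast
          show "c *s x \<in> {v. \<exists>a b. v = A Y1 a + A Y2 b}"
            unfolding ab by (auto simp: vec.scale_right_distrib intro!: exI[of _ "c *s _"])
          assume "y \<in> {v. \<exists>a b. v = A Y1 a + A Y2 b}"
          then obtain a' b' where "y = A Y1 a' + A Y2 b'" by blast
          then have "x + y = A Y1 (a + a') + A Y2 (b + b')"
            by (simp add: ab)
          then show "x + y \<in> {v. \<exists>a b. v = A Y1 a + A Y2 b}" by blast
        qed
      next
        case (step x)
        then obtain ws where ws: "set ws \<subseteq> {GY1, GY2}" "x = f ws" by blast
        show ?case
        proof (cases ws)
          \<comment> \<open>Nonempty words are visibly images of \<open>Y1\<close> or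
            \<open>Y2\<close>; for the empty word this is the hypothesis that \<open>s\<close>
            itself lies in the sum of the images.\<close>
          case Nil
          then show ?thesis using ws s by auto
        next
          case (Cons g ws')
          then consider "x = A Y1 (f ws') + A Y2 0" | "x = A Y1 0 + A Y2 (f ws')"
            using ws by auto
          then show ?thesis by blast
        qed
      qed
    qed
    then show ?thesis
      using Y_image_sum_eq_0[OF n_pos] by blast
  qed (use sU in auto)
qed

end

section \<open>The module \<open>L(n, n + 1)\<close>\<close>

locale L_mod = uq_mod n q \<phi> for n :: nat and q :: "'k::{field, field_char_0}"
    and \<phi> :: "'k falg set \<Rightarrow> 'k ^ 'd ^ ('d :: finite)" +
  fixes w :: "'k ^ 'd"
  assumes n_gt: "n > 1" and n_even: "even n" and primitive: "primitive_root_of_unity (2 * n) q"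
    and W_simple: "simple_uq_module n q \<phi>"
    and w_nz: "w \<noteq> 0" and X_w: "A X1 w = 0" "A X2 w = 0"
    and K_w: "A K1 w = q ^ n *s w" "A K2 w = q ^ (n + 1) *s w"
begin

lemma q_pow_2n: "q ^ (2 * n) = 1"
  using primitive by (simp add: primitive_root_of_unity_def)

lemma q_neq_0 [simp]: "q \<noteq> 0"
  using q_pow_2n n_gt
  by (metis power_0_left zero_neq_one mult_is_0 not_one_less_zero zero_neq_numeral)

lemma q_pow_n: "q ^ n = - 1"
proof -
  have "q ^ n \<noteq> 1"
    using primitive n_gt by (simp add: primitive_root_of_unity_def)
  moreover have "(q ^ n) ^ 2 = 1"
    using q_pow_2n by (simp add: mult.commute flip: power_mult)
  ultimately show ?thesis
    by (simp add: power2_eq_1_iff)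
qed

lemma q_neq_1 [simp]: "q \<noteq> 1"
  using q_pow_n by auto

lemma q_neq_m1 [simp]: "1 + q \<noteq> 0"
proof
  assume "1 + q = 0"
  then have "q ^ 2 = 1"
    by (simp add: power2_eq_1_iff add_eq_0_iff)
  then show False
    using primitive n_gt unfolding primitive_root_of_unity_def
    by (metis One_nat_def Suc_lessI mult.right_neutral mult_less_cancel1 numeral_2_eq_2 pos2
        zero_less_numeral)
qed

sublocale simple_uq_mod n q \<phi>
  by unfold_locales (use W_simple n_gt in auto)

abbreviation p where "p \<equiv> inverse q"

definition e0 where "e0 = w"
definition e1 where "e1 = A Y1 w"
definition e2 where "e2 = A Y2 w"
definition e3 where "e3 = A Y1 (A Y2 w)"

lemma K1_e [simp]:
  "A K1 e0 = - e0" "A K1 e1 = - p *s e1" "A K1 e2 = - e2" "A K1 e3 = - p *s e3"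
  by (simp_all add: e0_def e1_def e2_def e3_def K_Y K_w q_pow_n vector_sneg_minus1[symmetric])

lemma K2_e [simp]:
  "A K2 e0 = - q *s e0" "A K2 e1 = - q *s e1" "A K2 e2 = - e2" "A K2 e3 = - e3"
  by (simp_all add: e0_def e1_def e2_def e3_def K_Y K_w q_pow_n vector_sneg_minus1[symmetric])

lemma add_self_vec: "v + v = 2 *s (v :: 'k ^ 'd)"
  by (simp add: vec_eq_iff)

text \<open>The ratio is forced by \<open>X2\<close>, which sends \<open>A Y2 e1\<close> to (1 + p)
  \<open>e1\<close> and \<open>e3\<close> to 2 \<open>e1\<close>. \<open>X1\<close> sends them to (1
  + p) \<open>e2\<close> and 2 \<open>e2\<close>, the same ratio, so the difference is
  singular.\<close>

lemma Y21: "A Y2 (A Y1 w) = ((1 + p) / 2) *s e3"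
proof -
  let ?s = "A Y2 e1 - ((1 + p) / 2) *s e3"
  have "?s = 0"
  proof (rule singular_eq_0)
    show "?s = A Y1 (- ((1 + p) / 2) *s A Y2 w) + A Y2 e1"
      by (simp add: e3_def)
    show "A K1 ?s = - p *s ?s"
      by (simp add: K_Y vec.scale_right_diff_distrib)
    show "A K2 ?s = - 1 *s ?s"
      by (simp add: K_Y vec.scale_right_diff_distrib) (simp add: vec_eq_iff field_simps)
    show "A X1 ?s = 0"
      unfolding e3_def e1_def
      by (simp add: X_Y X1_Y2 X_w K_Y K_w q_pow_n add_self_vec) (simp add: vec_eq_iff field_simps)
    show "A X2 ?s = 0"
      unfolding e3_def e1_def
      by (simp add: X_Y X1_Y2 X_w K_Y K_w q_pow_n add_self_vec) (simp add: vec_eq_iff field_simps)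
  qed
  then show ?thesis
    by (simp add: e1_def)
qed

lemma p_neq_m1 [simp]: "1 + p \<noteq> 0"
  using q_neq_m1 by (simp add: field_simps del: q_neq_m1)

lemma Y_e [simp]:
  "A Y1 e0 = e1" "A Y1 e1 = 0" "A Y1 e2 = e3" "A Y1 e3 = 0"
  "A Y2 e0 = e2" "A Y2 e1 = ((1 + p) / 2) *s e3" "A Y2 e2 = 0" "A Y2 e3 = 0"
proof -
  have *: "x \<noteq> 0 \<Longrightarrow> 2 / x * (x / 2) = 1" for x :: 'k
    by simp
  \<comment> \<open>As 1 + p is invertible, \<open>e3\<close> is a multiple of a
    \<open>Y2\<close>-image and so is killed by \<open>Y2\<close>.\<close>
  have "e3 = (2 / (1 + p)) *s A Y2 (A Y1 w)"
    unfolding Y21 vector_smult_assoc using *[OF p_neq_m1] by (simp only: vector_smult_lid)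
  then show "A Y2 e3 = 0"
    by simp
qed (simp_all add: e0_def e1_def e2_def Y21, simp_all add: e3_def)

lemma X_e [simp]:
  "A X1 e0 = 0" "A X1 e1 = (1 + q) *s e0" "A X1 e2 = 0" "A X1 e3 = 2 *s e2"
  "A X2 e0 = 0" "A X2 e1 = 0" "A X2 e2 = 2 *s e0" "A X2 e3 = 2 *s e1"
  by (simp_all add: e0_def e1_def e2_def e3_def X_Y X1_Y2 X_w K_Y K_w q_pow_n
      add_self_vec vec.scale_left_distrib)

text \<open>Raising operators isolate the coefficients: \<open>X2\<close> after \<open>X1\<close>
  sends \<open>e3\<close> to 4 \<open>e0\<close> and kills the other three vectors; with
  \<open>d\<close> gone, \<open>X1\<close> sees only \<open>e1\<close> and \<open>X2\<close> only
  \<open>e2\<close>.\<close>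

lemma e_indep:
  assumes "a *s e0 + b *s e1 + c *s e2 + d *s e3 = 0"
  shows "a = 0 \<and> b = 0 \<and> c = 0 \<and> d = 0"
proof -
  have e0: "e0 \<noteq> 0" using w_nz by (simp add: e0_def)
  have d: "d = 0" using arg_cong[OF assms, of "\<lambda>v. A X2 (A X1 v)"] e0 by simp
  have "(b * (1 + q)) *s e0 = 0"
    using arg_cong[OF assms, of "A X1"] d by (simp add: vec.scale_left_distrib distrib_left)
  then have b: "b = 0"
    using e0 q_neq_m1 by (simp only: vector_mul_eq_0 mult_eq_0_iff) blast
  have c: "c = 0" using arg_cong[OF assms, of "A X2"] e0 d by simp
  show ?thesis using assms b c d e0 by simp
qed

text \<open>The action tables show that the span is stable under the generators, so it is a nonzero
  submodule and simplicity applies.\<close>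

lemma e_span: "vec.span {e0, e1, e2, e3} = UNIV"
proof -
  let ?U = "vec.span {e0, e1, e2, e3}"
  have U: "vec.subspace ?U" by (rule vec.subspace_span)
  note UI = vec.subspace_add[OF U] vec.subspace_scale[OF U] vec.subspace_0[OF U]
    vec.subspace_neg[OF U]
  have e: "e0 \<in> ?U" "e1 \<in> ?U" "e2 \<in> ?U" "e3 \<in> ?U"
    by (simp_all add: vec.span_base)
  have "A (gen g) v \<in> ?U" if "v \<in> ?U" for g v
    using that
  proof (induction rule: vec.span_induct)
    case base
    show ?case unfolding vec.subspace_def by (auto intro: UI)
  next
    case (step x)
    then show ?case by (cases g) (auto simp: UI e)
  qed
  then have "?U = {0} \<or> ?U = UNIV"
    by (rule submodule_cases[OF U])
  moreover have "e0 \<in> ?U" "e0 \<noteq> 0"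
    using w_nz by (auto simp: e0_def vec.span_base)
  ultimately show ?thesis by blast
qed

lemma e_expand: "\<exists>a b c d. v = a *s e0 + b *s e1 + c *s e2 + d *s e3"
proof -
  have "v \<in> vec.span {e0, e1, e2, e3}" by (simp add: e_span)
  then obtain a b c d where "v - a *s e0 - b *s e1 - c *s e2 - d *s e3 = 0"
    unfolding vec.span_breakdown_eq vec.span_empty by (auto simp: algebra_simps)
  then have "v = a *s e0 + b *s e1 + c *s e2 + d *s e3"
    by (simp add: algebra_simps)
  then show ?thesis by blast
qed

end

section \<open>The braiding\<close>

lemma sum_R_index:
  "(\<Sum>t\<in>R_index n. f t) =
    (\<Sum>b1\<in>{0, 1}. \<Sum>b2\<in>{0, 1}. \<Sum>b<2 * n. \<Sum>i1<2 * n. \<Sum>i2<2 * n. f (b1, b2, b, i1, i2))"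
  unfolding R_index_def sum.cartesian_product by (simp add: case_prod_unfold)

definition tens :: "'k::field ^ 'a::finite \<Rightarrow> 'k ^ 'b::finite \<Rightarrow> 'k ^ ('a \<times> 'b)"
  where "tens v w = (\<chi> ik. v $ fst ik * w $ snd ik)"

lemma tens_simps [simp]:
  "tens (c *s v) w = c *s tens v w" "tens v (c *s w) = c *s tens v w"
  "tens (- v) w = - tens v w" "tens v (- w) = - tens v w"
  "tens (v + v') w = tens v w + tens v' w" "tens v (w + w') = tens v w + tens v w'"
  "tens (v - v') w = tens v w - tens v' w" "tens v (w - w') = tens v w - tens v w'"
  "tens 0 w = 0" "tens v 0 = 0"
  by (simp_all add: tens_def vec_eq_iff algebra_simps)

text \<open>Frees the braiding from coordinates, so that it can be evaluated on the
  \<open>e0\<close>, ..., \<open>e3\<close>, which need not be coordinate vectors.\<close>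

lemma braiding_tens:
  "braiding n q \<phi> *v tens v w =
    (\<Sum>t\<in>R_index n. tens (act n q \<phi> (R_right n q t) *v w) (act n q \<phi> (R_left n q t) *v v))"
proof -
  have "(braiding n q \<phi> *v tens v w) $ (i, j) =
    (\<Sum>t\<in>R_index n. tens (act n q \<phi> (R_right n q t) *v w) (act n q \<phi> (R_left n q t) *v v)) $ (i, j)"
    for i j
  proof -
    have "(braiding n q \<phi> *v tens v w) $ (i, j) =
      (\<Sum>kl\<in>UNIV \<times> UNIV. \<Sum>t\<in>R_index n. act n q \<phi> (R_right n q t) $ i $ snd kl *
        act n q \<phi> (R_left n q t) $ j $ fst kl * (v $ fst kl * w $ snd kl))"
      by (simp add: braiding_def matrix_vector_mult_def tens_def sum_distrib_right)
    also have "\<dots> = (\<Sum>t\<in>R_index n. \<Sum>kl\<in>UNIV \<times> UNIV. act n q \<phi> (R_right n q t) $ i $ snd kl *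
        act n q \<phi> (R_left n q t) $ j $ fst kl * (v $ fst kl * w $ snd kl))"
      by (rule sum.swap)
    also have "\<dots> = (\<Sum>t\<in>R_index n. (\<Sum>l\<in>UNIV. act n q \<phi> (R_right n q t) $ i $ l * w $ l) *
       (\<Sum>k\<in>UNIV. act n q \<phi> (R_left n q t) $ j $ k * v $ k))"
    proof (rule sum.cong[OF refl])
      fix t
      let ?r = "\<lambda>l. act n q \<phi> (R_right n q t) $ i $ l"
        and ?l = "\<lambda>k. act n q \<phi> (R_left n q t) $ j $ k"
      have "(\<Sum>l\<in>UNIV. ?r l * w $ l) * (\<Sum>k\<in>UNIV. ?l k * v $ k) =
        (\<Sum>k\<in>UNIV. \<Sum>l\<in>UNIV. ?r l * ?l k * (v $ k * w $ l))"
        unfolding sum_product by (subst sum.swap) (simp only: mult_ac)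
      then show "(\<Sum>kl\<in>UNIV \<times> UNIV. ?r (snd kl) * ?l (fst kl) * (v $ fst kl * w $ snd kl)) =
        (\<Sum>l\<in>UNIV. ?r l * w $ l) * (\<Sum>k\<in>UNIV. ?l k * v $ k)"
        by (simp only: sum.cartesian_product case_prod_unfold)
    qed
    finally show ?thesis
      by (simp add: matrix_vector_mult_def tens_def)
  qed
  then show ?thesis
    unfolding vec_eq_iff by auto
qed

context L_mod
begin

section \<open>Weight idempotents\<close>

lemma q_pow_eq_iff:
  assumes "i < 2 * n" "j < 2 * n"
  shows "q ^ i = q ^ j \<longleftrightarrow> i = j"
proof
  have *: "\<not> i < j" if "q ^ i = q ^ j" "j < 2 * n" for i j
  proof
    assume "i < j"
    then have "q ^ (j - i) = 1"
      using that by (simp add: power_diff)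
    then show False
      using primitive \<open>i < j\<close> that unfolding primitive_root_of_unity_def by simp
  qed
  show "i = j" if "q ^ i = q ^ j"
    using *[of i j] *[of j i] that assms by auto
qed auto

text \<open>Orthogonality of the characters of Z/2n: a geometric sum over a 2n-th root of unity,
  which equals 1 only when \<open>i = r\<close>.\<close>

lemma root_sum:
  assumes "i < 2 * n" "r < 2 * n"
  shows "(\<Sum>a<2 * n. p ^ (i * a) * q ^ (r * a)) = (if i = r then of_nat (2 * n) else 0)"
proof -
  let ?x = "p ^ i * q ^ r"
  have eq: "p ^ (i * a) * q ^ (r * a) = ?x ^ a" for a
    by (simp add: power_mult power_mult_distrib)
  have "?x = 1 \<longleftrightarrow> q ^ r = q ^ i"
    by (simp add: field_simps)
  then have x: "?x = 1 \<longleftrightarrow> i = r"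
    using q_pow_eq_iff[OF assms] by auto
  have "?x ^ (2 * n) = 1"
  proof -
    have "?x ^ (2 * n) = inverse ((q ^ (2 * n)) ^ i) * (q ^ (2 * n)) ^ r"
      by (simp only: power_mult_distrib power_inverse flip: power_mult) (simp only: mult.commute)
    then show ?thesis
      by (simp add: q_pow_2n)
  qed
  then show ?thesis
    unfolding eq using x by (auto simp: sum_gp_strict)
qed

lemma weight_exponents: "p ^ (i * a + j * b) * (q ^ r) ^ a * (q ^ s) ^ b =
    (p ^ (i * a) * q ^ (r * a)) * (p ^ (j * b) * q ^ (s * b))"
  by (simp add: power_add power_mult)

lemma idem_sum:
  assumes "i < 2 * n" "j < 2 * n" "r < 2 * n" "s < 2 * n"
  shows "inverse (of_nat (2 * n) ^ 2) *
      (\<Sum>a<2 * n. \<Sum>b<2 * n. p ^ (i * a + j * b) * (q ^ r) ^ a * (q ^ s) ^ b) =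
    (if i = r \<and> j = s then 1 else 0)"
proof -
  define c :: 'k where "c = of_nat (2 * n)"
  have "c \<noteq> 0"
    using n_pos unfolding c_def of_nat_eq_0_iff by simp
  then show ?thesis
    unfolding weight_exponents sum_product[symmetric] root_sum[OF assms(1,3)] root_sum[OF assms(2,4)]
      c_def[symmetric]
    by (simp add: power2_eq_square field_simps)
qed

lemma A_weight_idem:
  assumes "A K1 v = q ^ r *s v" "A K2 v = q ^ s *s v"
    and "i < 2 * n" "j < 2 * n" "r < 2 * n" "s < 2 * n"
  shows "A (weight_idem n q i j) v = (if i = r \<and> j = s then v else 0)"
proof -
  have "A (weight_idem n q i j) v = (inverse (of_nat (2 * n) ^ 2) *
      (\<Sum>a<2 * n. \<Sum>b<2 * n. p ^ (i * a + j * b) * (q ^ r) ^ a * (q ^ s) ^ b)) *s v"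
    unfolding weight_idem_def
    by (simp only: A_mult A_sum A_cst A_scale A_power_eigen[OF assms(1)] A_power_eigen[OF assms(2)]
        sum_distrib_left vec.scale_sum_left vec.scale_sum_right vec.scale_scale mult_ac)
  then show ?thesis
    unfolding idem_sum[OF assms(3-6)] by simp
qed

section \<open>The surviving terms of the R-matrix\<close>

lemma one_minus_q_neq_0 [simp]: "1 - q \<noteq> 0"
  using q_neq_1 by simp

lemma x21_e [simp]:
  "A x21 e0 = 0" "A x21 e1 = 0" "A x21 e2 = 0" "A x21 e3 = (2 * (1 - q)) *s e0"
  by (simp_all add: x21_def) (simp add: vec_eq_iff algebra_simps)

lemma y12_e [simp]:
  "A (y12 q) e0 = ((1 - q) / 2) *s e3" "A (y12 q) e1 = 0" "A (y12 q) e2 = 0" "A (y12 q) e3 = 0"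
  by (simp_all add: y12_def) (simp add: vec_eq_iff field_simps)

lemma x21_square [simp]: "A x21 (A x21 v) = 0"
proof -
  obtain a b c d where "v = a *s e0 + b *s e1 + c *s e2 + d *s e3"
    using e_expand by blast
  then show ?thesis by simp
qed

lemma x21_nilpotent: "A (x21 ^ Suc (Suc k)) v = 0"
  by (simp add: power_Suc2 del: power_Suc)

lemma sum_lessThan_two_terms:
  assumes "\<And>b. f (Suc (Suc b)) = (0 :: 'k ^ 'x)"
  shows "(\<Sum>b<2 * n. f b) = f 0 + f 1"
proof -
  have "2 * n = Suc (Suc (2 * (n - 1)))"
    using n_gt by simp
  then show ?thesis
    using assms by (simp add: sum.lessThan_Suc_shift del: sum.lessThan_Suc)
qed

lemma y12_div_0 [simp]: "y12_div q 0 = 1"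
  and y12_div_1: "y12_div q (Suc 0) = cst (inverse (1 - q)) * y12 q"
  by (simp_all add: y12_div_def qfact_def qnum_def)

lemma sum_sum_delta:
  fixes m :: nat
  assumes "r < m" "s < m"
  shows "(\<Sum>i<m. \<Sum>j<m. if i = r \<and> j = s then f i j else 0) = (f r s :: 'a::comm_monoid_add)"
proof -
  have "(\<Sum>j<m. if i = r \<and> j = s then f i j else 0) = (if i = r then f r s else 0)" for i
    using assms by (cases "i = r") simp_all
  then show ?thesis
    using assms by simp
qed

text \<open>The idempotent is the first factor of \<open>R_right\<close> to act on \<open>e\<close>,
  so it collapses the sum over the torus indices to the weight of \<open>e\<close>;
  \<open>x21\<close> squares to zero on the module, which cuts the sum over \<open>b\<close> to two
  terms.\<close>

lemma braiding_weight:
  assumes e: "A K1 e = q ^ r *s e" "A K2 e = q ^ s *s e" "r < 2 * n" "s < 2 * n"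
  shows "braiding n q \<phi> *v tens v e =
    (\<Sum>b1\<in>{0, 1}. \<Sum>b2\<in>{0, 1}. \<Sum>b\<in>{0, 1}.
      tens (A (X1 ^ b1 * x21 ^ b * X2 ^ b2) e)
        (A (K1 ^ (n * r + s) * K2 ^ (n * s) * Y2 ^ b2 * y12_div q b * Y1 ^ b1) v))"
proof -
  let ?T = "\<lambda>b1 b2 b i1 i2. tens (A (X1 ^ b1 * x21 ^ b * X2 ^ b2) e)
        (A (K1 ^ (n * i1 + i2) * K2 ^ (n * i2) * Y2 ^ b2 * y12_div q b * Y1 ^ b1) v)"
  have *: "tens (A (R_right n q (b1, b2, b, i1, i2)) e) (A (R_left n q (b1, b2, b, i1, i2)) v) =
    (if i1 = r \<and> i2 = s then ?T b1 b2 b i1 i2 else 0)"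
    if "i1 < 2 * n" "i2 < 2 * n" for b1 b2 b i1 i2
    using A_weight_idem[OF e(1,2) that e(3,4)] by (simp add: R_right_def R_left_def)
  have S: "(\<Sum>i1<2 * n. \<Sum>i2<2 * n. tens (A (R_right n q (b1, b2, b, i1, i2)) e)
      (A (R_left n q (b1, b2, b, i1, i2)) v)) = ?T b1 b2 b r s" for b1 b2 b
  proof -
    have "(\<Sum>i1<2 * n. \<Sum>i2<2 * n. tens (A (R_right n q (b1, b2, b, i1, i2)) e)
      (A (R_left n q (b1, b2, b, i1, i2)) v)) =
      (\<Sum>i1<2 * n. \<Sum>i2<2 * n. if i1 = r \<and> i2 = s then ?T b1 b2 b i1 i2 else 0)"
      by (intro sum.cong refl *) auto
    also have "\<dots> = ?T b1 b2 b r s"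
      by (rule sum_sum_delta[OF e(3,4)])
    finally show ?thesis .
  qed
  have "(\<Sum>b<2 * n. ?T b1 b2 b r s) = (\<Sum>b\<in>{0, 1}. ?T b1 b2 b r s)" for b1 b2
    by (subst sum_lessThan_two_terms) (simp_all add: x21_nilpotent del: power_Suc)
  then show ?thesis
    unfolding braiding_tens sum_R_index S by simp
qed

text \<open>The torus part is held in a variable \<open>D\<close>, so that each instance can replace
  it by a diagonal operator with known values instead of large powers.\<close>

lemma braiding_weight_expand:
  assumes e: "A K1 e = q ^ r *s e" "A K2 e = q ^ s *s e" "r < 2 * n" "s < 2 * n"
    and D: "D = (\<lambda>v. A (K1 ^ (n * r + s)) (A (K2 ^ (n * s)) v))"
  shows "braiding n q \<phi> *v tens v e =
    tens e (D v) + tens (A X2 e) (D (A Y2 v)) + tens (A X1 e) (D (A Y1 v)) +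
    tens (A X1 (A X2 e)) (D (A Y2 (A Y1 v))) + tens (A x21 e) (D (inverse (1 - q) *s A (y12 q) v)) +
    tens (A x21 (A X2 e)) (D (A Y2 (inverse (1 - q) *s A (y12 q) v))) +
    tens (A X1 (A x21 e)) (D (inverse (1 - q) *s A (y12 q) (A Y1 v))) +
    tens (A X1 (A x21 (A X2 e))) (D (A Y2 (inverse (1 - q) *s A (y12 q) (A Y1 v))))"
  unfolding D braiding_weight[OF e] by (simp add: y12_div_1 algebra_simps)

text \<open>The eigenvalues -1, -q and -p are written as powers of \<open>q\<close> with exponents
  below 2n, the form in which the idempotents recognise them.\<close>

lemma weights:
  "A K1 e0 = q ^ n *s e0" "A K2 e0 = q ^ (n + 1) *s e0"
  "A K1 e1 = q ^ (n - 1) *s e1" "A K2 e1 = q ^ (n + 1) *s e1"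
  "A K1 e2 = q ^ n *s e2" "A K2 e2 = q ^ n *s e2"
  "A K1 e3 = q ^ (n - 1) *s e3" "A K2 e3 = q ^ n *s e3"
proof -
  have "q ^ (n - 1) = - p"
    using q_pow_n n_gt by (simp add: power_diff field_simps)
  then show "A K1 e0 = q ^ n *s e0" "A K2 e0 = q ^ (n + 1) *s e0"
  "A K1 e1 = q ^ (n - 1) *s e1" "A K2 e1 = q ^ (n + 1) *s e1"
  "A K1 e2 = q ^ n *s e2" "A K2 e2 = q ^ n *s e2"
  "A K1 e3 = q ^ (n - 1) *s e3" "A K2 e3 = q ^ n *s e3"
    by (simp_all add: q_pow_n)
qed

lemma weights_lt: "n < 2 * n" "n + 1 < 2 * n" "n - 1 < 2 * n"
  using n_gt by auto

lemma K1_power_e [simp]: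
  "A (K1 ^ k) e0 = (- 1) ^ k *s e0" "A (K1 ^ k) e1 = (- p) ^ k *s e1"
  "A (K1 ^ k) e2 = (- 1) ^ k *s e2" "A (K1 ^ k) e3 = (- p) ^ k *s e3"
  by (rule A_power_eigen, simp)+

lemma K2_power_e [simp]:
  "A (K2 ^ k) e0 = (- q) ^ k *s e0" "A (K2 ^ k) e1 = (- q) ^ k *s e1"
  "A (K2 ^ k) e2 = (- 1) ^ k *s e2" "A (K2 ^ k) e3 = (- 1) ^ k *s e3"
  by (rule A_power_eigen, simp)+

lemma p_pow_n: "p ^ n = - 1"
  by (simp add: power_inverse q_pow_n)

text \<open>Here the parity of \<open>n\<close> enters: raising to an even power removes the
  sign.\<close>

lemma neg_pow_n: "(- p) ^ n = - 1" "(- q) ^ n = - 1"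
  using n_even by (simp_all add: p_pow_n q_pow_n)

lemma odd_pred_n: "odd (n - 1)"
  using n_even n_gt by simp

text \<open>\<open>D\<^sub>l\<close> is the diagonal operator \<open>\<kappa>\<^sub>1\<^bsup>nr+s\<^esup> \<kappa>\<^sub>2\<^bsup>ns\<^esup>\<close> attached to the weight \<open>(r, s)\<close> of \<open>e\<^sub>l\<close>.\<close>

definition "D0 v = A (K1 ^ (n * n + (n + 1))) (A (K2 ^ (n * (n + 1))) v)"
definition "D1 v = A (K1 ^ (n * (n - 1) + (n + 1))) (A (K2 ^ (n * (n + 1))) v)"
definition "D2 v = A (K1 ^ (n * n + n)) (A (K2 ^ (n * n)) v)"
definition "D3 v = A (K1 ^ (n * (n - 1) + n)) (A (K2 ^ (n * n)) v)"

lemma D_linear [simp]: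
  "D0 0 = 0" "D1 0 = 0" "D2 0 = 0" "D3 0 = 0"
  "D0 (c *s v) = c *s D0 v" "D1 (c *s v) = c *s D1 v" "D2 (c *s v) = c *s D2 v"
  "D3 (c *s v) = c *s D3 v"
  by (simp_all add: D0_def D1_def D2_def D3_def)

lemma D_e [simp]:
  "D0 e0 = e0" "D0 e1 = - p *s e1" "D0 e2 = - e2" "D0 e3 = p *s e3"
  "D1 e0 = e0" "D1 e1 = p *s e1" "D1 e2 = - e2" "D1 e3 = - p *s e3"
  "D2 e0 = e0" "D2 e1 = - e1" "D2 e2 = e2" "D2 e3 = - e3"
  "D3 e0 = e0" "D3 e1 = e1" "D3 e2 = e2" "D3 e3 = e3"
  unfolding D0_def D1_def D2_def D3_def K1_power_e K2_power_e A_scale vec.scale_scale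
  using n_even odd_pred_n
  by (simp_all add: power_add power_mult neg_pow_n q_pow_n p_pow_n)

abbreviation B where "B \<equiv> (*v) (braiding n q \<phi>)"

lemmas braiding_e =
  braiding_weight_expand[OF weights(1,2) weights_lt(1,2), of D0, OF ext, OF D0_def]
  braiding_weight_expand[OF weights(3,4) weights_lt(3,2), of D1, OF ext, OF D1_def]
  braiding_weight_expand[OF weights(5,6) weights_lt(1,1), of D2, OF ext, OF D2_def]
  braiding_weight_expand[OF weights(7,8) weights_lt(3,1), of D3, OF ext, OF D3_def]

text \<open>The coefficient 3 + p is (1 + q)(1 + p), from \<open>X1 * X2\<close> against
  \<open>Y2 * Y1\<close>, plus 1 - q, from \<open>x21\<close> against \<open>y12\<close>; the terms
  in \<open>q\<close> cancel and only \<open>p\<close> is left.\<close>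

lemma braiding_ee:
  "B (tens e0 e0) = tens e0 e0"
  "B (tens e0 e1) = tens e1 e0 + (1 + p) *s tens e0 e1"
  "B (tens e1 e0) = - p *s tens e0 e1"
  "B (tens e0 e2) = tens e2 e0 + 2 *s tens e0 e2"
  "B (tens e2 e0) = - tens e0 e2"
  "B (tens e1 e1) = p *s tens e1 e1"
  "B (tens e2 e2) = tens e2 e2"
  "B (tens e3 e3) = tens e3 e3"
  "B (tens e0 e3) = tens e3 e0 + 2 *s tens e2 e1 + 2 *s tens e1 e2 + (3 + p) *s tens e0 e3"
  "B (tens e3 e0) = p *s tens e0 e3"
  "B (tens e1 e2) = - tens e2 e1 - (1 + p) *s tens e0 e3"
  "B (tens e2 e1) = - tens e1 e2 - (1 + p) *s tens e0 e3"
  "B (tens e1 e3) = tens e3 e1 + (1 + p) *s tens e1 e3"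
  "B (tens e3 e1) = - p *s tens e1 e3"
  "B (tens e2 e3) = tens e3 e2 + 2 *s tens e2 e3"
  "B (tens e3 e2) = - tens e2 e3"
  by (simp_all add: braiding_e vec.scale_left_distrib) (simp_all add: vec_eq_iff field_simps)

end

section \<open>The twist\<close>

context L_mod
begin

definition S1 where "S1 v = A (antipode n X1) v"
definition S2 where "S2 v = A (antipode n X2) v"
definition S21 where "S21 v = A (antipode n x21) v"

lemma S_linear [simp]:
  "S1 0 = 0" "S1 (c *s v) = c *s S1 v" "S1 (v + v') = S1 v + S1 v'"
  "S2 0 = 0" "S2 (c *s v) = c *s S2 v" "S2 (v + v') = S2 v + S2 v'"
  "S1 (v - v') = S1 v - S1 v'" "S2 (v - v') = S2 v - S2 v'" "S21 (v - v') = S21 v - S21 v'"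
  "S21 0 = 0" "S21 (c *s v) = c *s S21 v" "S21 (v + v') = S21 v + S21 v'"
  by (simp_all add: S1_def S2_def S21_def)

text \<open>The inverses of the torus generators are encoded as powers 2n - 1. Each of -p, -q, -1
  has n-th power 1 or -1, so this power inverts it.\<close>

lemma neg_pow_pred: "(- p) ^ (2 * n - 1) = - q" "(- q) ^ (2 * n - 1) = - p"
   "(- 1) ^ (2 * n - 1) = (- 1 :: 'k)" "(- p) ^ (n - 1) = q"
proof -
  have pred: "x ^ (k - 1) = x ^ k * inverse x" if "k > 0" "x \<noteq> 0" for x :: 'k and k
    using that by (cases k) simp_all
  have *: "x ^ (2 * n - 1) = inverse x" if "x ^ n = - 1 \<or> x ^ n = 1" "x \<noteq> 0" for x :: 'k
  proof -
    have "x ^ (2 * n) = (x ^ n) ^ 2"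
      by (simp add: mult.commute flip: power_mult)
    then show ?thesis
      using that n_pos by (subst pred) auto
  qed
  show "(- p) ^ (2 * n - 1) = - q" "(- q) ^ (2 * n - 1) = - p" "(- 1) ^ (2 * n - 1) = (- 1 :: 'k)"
    using *[of "- p"] *[of "- q"] *[of "- 1"] neg_pow_n n_even by auto
  show "(- p) ^ (n - 1) = q"
    using n_pos by (subst pred) (auto simp: neg_pow_n)
qed

lemma K_inv_e [simp]:
  "A (K1_inv n) e0 = - e0" "A (K1_inv n) e1 = - q *s e1"
  "A (K1_inv n) e2 = - e2" "A (K1_inv n) e3 = - q *s e3"
  "A (K2_inv n) e0 = - p *s e0" "A (K2_inv n) e1 = - p *s e1"
  "A (K2_inv n) e2 = - e2" "A (K2_inv n) e3 = - e3"
  unfolding K1_inv_def K2_inv_def K1_power_e K2_power_e neg_pow_pred by simp_all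

lemma K_inv_power_e [simp]:
  "A (K1_inv n ^ n) e0 = e0" "A (K1_inv n ^ n) e2 = e2"
  "A (K2_inv n ^ n) e0 = - e0" "A (K2_inv n ^ n) e1 = - e1"
  using n_even A_power_eigen[of "K1_inv n" e0 "- 1" n] A_power_eigen[of "K1_inv n" e2 "- 1" n]
    A_power_eigen[of "K2_inv n" e0 "- p" n] A_power_eigen[of "K2_inv n" e1 "- p" n]
  by (simp_all add: p_pow_n)

lemma S_e [simp]:
  "S1 e0 = 0" "S1 e1 = (1 + p) *s e0" "S1 e2 = 0" "S1 e3 = 2 *s e2"
  "S2 e0 = 0" "S2 e1 = 0" "S2 e2 = 2 *s e0" "S2 e3 = 2 *s e1"
  by (simp_all add: S1_def S2_def)

lemma S21_eq: "S21 v = S1 (S2 v) - S2 (S1 v)"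
  by (simp add: S21_def S1_def S2_def x21_def antipode_diff antipode_mult del: antipode_gen)

lemma S21_e [simp]:
  "S21 e0 = 0" "S21 e1 = 0" "S21 e2 = 0" "S21 e3 = (2 * (p - 1)) *s e0"
  by (simp_all add: S21_eq) (simp_all add: vec_eq_iff field_simps)

lemma S21_square: "S21 (S21 v) = 0"
proof -
  obtain a b c d where "v = a *s e0 + b *s e1 + c *s e2 + d *s e3"
    using e_expand by blast
  then show ?thesis by simp
qed

lemma S21_nilpotent: "A (antipode n x21 ^ Suc (Suc k)) v = 0"
  using S21_square unfolding S21_def by (simp add: power_Suc2 del: power_Suc)

text \<open>The antipode inverts the torus generators, so the same orthogonality applies, now with
  the eigenvalues of the inverses.\<close>

lemma A_antipode_weight_idem:
  assumes "A (K1_inv n) v = q ^ r *s v" "A (K2_inv n) v = q ^ s *s v"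
    and "i < 2 * n" "j < 2 * n" "r < 2 * n" "s < 2 * n"
  shows "A (antipode n (weight_idem n q i j)) v = (if i = r \<and> j = s then v else 0)"
proof -
  have "A (antipode n (weight_idem n q i j)) v = (inverse (of_nat (2 * n) ^ 2) *
      (\<Sum>a<2 * n. \<Sum>b<2 * n. p ^ (i * a + j * b) * (q ^ r) ^ a * (q ^ s) ^ b)) *s v"
    unfolding weight_idem_def antipode_mult antipode_sum antipode_power antipode_cst antipode_gen
      antipode_gen.simps
    by (simp only: A_mult A_sum A_cst A_scale A_power_eigen[OF assms(1)] A_power_eigen[OF assms(2)]
        sum_distrib_left vec.scale_sum_left vec.scale_sum_right vec.scale_scale mult_ac)
  then show ?thesis
    unfolding idem_sum[OF assms(3-6)] by simp
qed

text \<open>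
  \<open>u_part k\<^sub>1 k\<^sub>2\<close> collects the terms of \<open>S(R\<^sup>(\<^sup>2\<^sup>)) R\<^sup>(\<^sup>1\<^sup>)\<close> that survive on the module, with \<open>S\<close> of the
  weight idempotent stripped off and the torus part replaced by \<open>\<kappa>\<^sub>1\<^bsup>k\<^sub>1\<^esup> \<kappa>\<^sub>2\<^bsup>k\<^sub>2\<^esup>\<close>.
\<close>

definition "y12_scaled v = inverse (1 - q) *s A (y12 q) v"

definition "u_part k1 k2 v = (let K = (\<lambda>v. A (K1 ^ k1) (A (K2 ^ k2) v)) in
  K v + S2 (K (A Y2 v)) + S1 (K (A Y1 v)) + S2 (S1 (K (A Y2 (A Y1 v)))) +
  S21 (K (y12_scaled v)) + S2 (S21 (K (A Y2 (y12_scaled v)))) + S21 (S1 (K (y12_scaled (A Y1 v)))) +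
  S2 (S21 (S1 (K (A Y2 (y12_scaled (A Y1 v)))))))"

text \<open>The antipode reverses products: the idempotent becomes the outermost factor and acts
  after everything else.\<close>

lemma A_drinfeld_u:
  "A (drinfeld_u n q) v = (\<Sum>i<2 * n. \<Sum>j<2 * n.
    A (antipode n (weight_idem n q i j)) (u_part (n * i + j) (n * j) v))"
proof -
  have "A (drinfeld_u n q) v = (\<Sum>b1\<in>{0, 1}. \<Sum>b2\<in>{0, 1}. \<Sum>b\<in>{0, 1}. \<Sum>i<2 * n. \<Sum>j<2 * n.
     A (antipode n (R_right n q (b1, b2, b, i, j))) (A (R_left n q (b1, b2, b, i, j)) v))"
  proof -
    let ?T = "\<lambda>b1 b2 b. \<Sum>i<2 * n. \<Sum>j<2 * n.
      A (antipode n (R_right n q (b1, b2, b, i, j))) (A (R_left n q (b1, b2, b, i, j)) v)"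
    have "(\<Sum>b<2 * n. ?T b1 b2 b) = (\<Sum>b\<in>{0, 1}. ?T b1 b2 b)" for b1 b2
      by (subst sum_lessThan_two_terms)
        (simp_all add: R_right_def antipode_mult antipode_power S21_nilpotent
          del: power_Suc antipode_gen)
    then show ?thesis
      unfolding drinfeld_u_def A_sum sum_R_index A_mult by simp
  qed
  then show ?thesis
    by (simp add: R_right_def R_left_def antipode_mult antipode_power y12_div_1 u_part_def Let_def y12_scaled_def
        S1_def S2_def S21_def sum.distrib del: antipode_gen)
qed

text \<open>Lowering by R^(1) and raising by S(R^(2)) compensate, so \<open>u_part\<close> only
  rescales \<open>v\<close>. The outer idempotent then selects the one pair of exponents that
  matches the weight.\<close>

lemma A_drinfeld_u_weight:
  assumes "A (K1_inv n) v = q ^ r *s v" "A (K2_inv n) v = q ^ s *s v"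
    and "r < 2 * n" "s < 2 * n"
    and H: "\<And>i j. u_part (n * i + j) (n * j) v = c i j *s v"
  shows "A (drinfeld_u n q) v = c r s *s v"
proof -
  have "A (drinfeld_u n q) v = (\<Sum>i<2 * n. \<Sum>j<2 * n. if i = r \<and> j = s then c i j *s v else 0)"
    unfolding A_drinfeld_u H A_scale
    by (intro sum.cong refl) (use A_antipode_weight_idem[OF assms(1,2) _ _ assms(3,4)] in auto)
  then show ?thesis
    using sum_sum_delta[OF assms(3,4), of "\<lambda>i j. c i j *s v"] by simp
qed

lemma u_part_e:
  "u_part k1 k2 e0 = ((- 1) ^ k1 * (- q) ^ k2 + (1 + p) * (- p) ^ k1 * (- q) ^ k2 +
     2 * (- 1) ^ k1 * (- 1) ^ k2 + 2 * (1 + p) * (- p) ^ k1 * (- 1) ^ k2 + (p - 1) * (- p) ^ k1 * (- 1) ^ k2) *s e0"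
  "u_part k1 k2 e1 = ((- p) ^ k1 * (- q) ^ k2 + (1 + p) * (- p) ^ k1 * (- 1) ^ k2) *s e1"
  "u_part k1 k2 e2 = ((- 1) ^ k1 * (- 1) ^ k2 + 2 * (- p) ^ k1 * (- 1) ^ k2) *s e2"
  "u_part k1 k2 e3 = ((- p) ^ k1 * (- 1) ^ k2) *s e3"
  by (simp_all add: u_part_def Let_def y12_scaled_def) (simp_all add: vec_eq_iff algebra_simps)

lemma K_inv_weights:
  "A (K1_inv n) e0 = q ^ n *s e0" "A (K2_inv n) e0 = q ^ (n - 1) *s e0"
  "A (K1_inv n) e1 = q ^ (n + 1) *s e1" "A (K2_inv n) e1 = q ^ (n - 1) *s e1"
  "A (K1_inv n) e2 = q ^ n *s e2" "A (K2_inv n) e2 = q ^ n *s e2"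
  "A (K1_inv n) e3 = q ^ (n + 1) *s e3" "A (K2_inv n) e3 = q ^ n *s e3"
proof -
  have q: "q ^ (n - 1) = - p" "q ^ (n + 1) = - q"
    using q_pow_n n_gt by (simp_all add: power_diff field_simps)
  show "A (K1_inv n) e0 = q ^ n *s e0" "A (K2_inv n) e0 = q ^ (n - 1) *s e0"
  "A (K1_inv n) e1 = q ^ (n + 1) *s e1" "A (K2_inv n) e1 = q ^ (n - 1) *s e1"
  "A (K1_inv n) e2 = q ^ n *s e2" "A (K2_inv n) e2 = q ^ n *s e2"
  "A (K1_inv n) e3 = q ^ (n + 1) *s e3" "A (K2_inv n) e3 = q ^ n *s e3"
    unfolding q q_pow_n by simp_all
qed

lemma drinfeld_u_e [simp]:
  "A (drinfeld_u n q) e0 = e0" "A (drinfeld_u n q) e1 = - e1"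
  "A (drinfeld_u n q) e2 = - e2" "A (drinfeld_u n q) e3 = e3"
  unfolding A_drinfeld_u_weight[OF K_inv_weights(1,2) weights_lt(1,3) u_part_e(1)]
    A_drinfeld_u_weight[OF K_inv_weights(3,4) weights_lt(2,3) u_part_e(2)]
    A_drinfeld_u_weight[OF K_inv_weights(5,6) weights_lt(1,1) u_part_e(3)]
    A_drinfeld_u_weight[OF K_inv_weights(7,8) weights_lt(2,1) u_part_e(4)]
  unfolding power_add power_mult neg_pow_n neg_pow_pred
  using n_even odd_pred_n by (simp_all add: vec_eq_iff field_simps)

lemma pivot_e [simp]:
  "A (pivot n) e0 = - e0" "A (pivot n) e1 = e1" "A (pivot n) e2 = e2" "A (pivot n) e3 = - e3"
  using n_even by (simp_all add: pivot_def neg_pow_n p_pow_n q_pow_n)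

text \<open>The Drinfeld element acts by the signs 1, -1, -1, 1. It is therefore its own inverse and
  the negative of the pivot, which also squares to the identity.\<close>

lemma twist_eq: "twist n q \<phi> = mat (- 1)"
proof -
  let ?U = "act n q \<phi> (drinfeld_u n q)"
  have ext: "M = M'" if M: "M *v e0 = M' *v e0" "M *v e1 = M' *v e1" "M *v e2 = M' *v e2"
    "M *v e3 = M' *v e3" for M M' :: "'k ^ 'd ^ 'd"
  proof -
    have "M *v v = M' *v v" for v
    proof -
      obtain a b c d where "v = a *s e0 + b *s e1 + c *s e2 + d *s e3"
        using e_expand by blast
      then show ?thesis by (simp add: vec.add vec.scale M)
    qed
    then show ?thesis by (simp add: matrix_eq)
  qed
  have U2: "?U ** ?U = mat 1"
    by (rule ext) (simp_all flip: matrix_vector_mul_assoc)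
  have "?U ** matrix_inv ?U = mat 1 \<and> matrix_inv ?U ** ?U = mat 1"
    unfolding matrix_inv_def by (rule someI[of _ ?U]) (simp add: U2)
  then have "matrix_inv ?U = ?U"
    using U2 by (metis matrix_mul_assoc matrix_mul_lid matrix_mul_rid)
  then show ?thesis
    unfolding twist_def by (intro ext) (simp_all flip: matrix_vector_mul_assoc)
qed

end

section \<open>Powers of the braiding and their partial traces\<close>

definition dot :: "'k::field ^ 'a::finite \<Rightarrow> 'k ^ 'a \<Rightarrow> 'k"
  where "dot f v = (\<Sum>k\<in>UNIV. f $ k * v $ k)"

definition contract :: "'k::field ^ 'b::finite \<Rightarrow> 'k ^ ('a::finite \<times> 'b) \<Rightarrow> 'k ^ 'a"
  where "contract f T = (\<chi> i. \<Sum>k\<in>UNIV. T $ (i, k) * f $ k)"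

lemma dot_simps [simp]:
  "dot f (v + w) = dot f v + dot f w" "dot f (c *s v) = c * dot f v" "dot f (- v) = - dot f v"
  by (simp_all add: dot_def algebra_simps sum.distrib sum_distrib_left sum_negf)

lemma contract_simps [simp]:
  "contract f (S + T) = contract f S + contract f T" "contract f (c *s T) = c *s contract f T"
  "contract f (- T) = - contract f T" "contract f (S - T) = contract f S - contract f T"
  "contract f (tens v w) = dot f w *s v"
  by (simp_all add: contract_def dot_def tens_def vec_eq_iff algebra_simps sum.distrib
      sum_distrib_left sum_negf sum_subtractf)

lemma dot_matrix: "dot (f v* M) v = dot f (M *v v)"
proof -
  have "dot (f v* M) v = (\<Sum>k\<in>UNIV. \<Sum>l\<in>UNIV. M $ l $ k * f $ l * v $ k)"
    by (simp add: dot_def vector_matrix_mult_def sum_distrib_right sum_distrib_left mult_ac)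
  also have "\<dots> = (\<Sum>l\<in>UNIV. \<Sum>k\<in>UNIV. M $ l $ k * f $ l * v $ k)"
    by (rule sum.swap)
  finally show ?thesis
    by (simp add: dot_def matrix_vector_mult_def sum_distrib_left mult_ac)
qed

context L_mod
begin

definition psum where "psum b = (\<Sum>i<b. p ^ i)"
definition torus_poly
  where "torus_poly b = of_nat b + 2 * (\<Sum>i = 1..b - 1. of_nat (b - i) * p ^ i)"

lemma psum_0 [simp]: "psum 0 = 0" and psum_Suc: "psum (Suc b) = psum b + p ^ b"
  by (simp_all add: psum_def)

lemma torus_poly_0 [simp]: "torus_poly 0 = 0"
  by (simp add: torus_poly_def)

text \<open>Passing from b to b + 1 raises the constant term by 1 and every other coefficient up to
  p^b by 2.\<close>

lemma torus_poly_Suc: "torus_poly (Suc b) = torus_poly b + 2 * psum b + 2 * p ^ b - 1"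
proof -
  have 1: "psum (Suc b) = 1 + (\<Sum>i = 1..b. p ^ i)"
    unfolding psum_def
    by (simp add: sum.lessThan_Suc_shift sum.atLeast1_atMost_eq del: sum.lessThan_Suc)
  then have S: "(\<Sum>i = 1..b. p ^ i) = psum b + p ^ b - 1"
    by (simp add: psum_Suc)
  have "(\<Sum>i = 1..b. of_nat (Suc b - i) * p ^ i) = (\<Sum>i = 1..b. of_nat (b - i) * p ^ i + p ^ i)"
    by (intro sum.cong) (auto simp: Suc_diff_le algebra_simps)
  also have "\<dots> = (\<Sum>i = 1..b - 1. of_nat (b - i) * p ^ i) + (psum b + p ^ b - 1)"
    unfolding sum.distrib S by (cases b) simp_all
  finally have *: "(\<Sum>i = 1..b. of_nat (Suc b - i) * p ^ i) =
    (\<Sum>i = 1..b - 1. of_nat (b - i) * p ^ i) + (psum b + p ^ b - 1)" .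
  have "torus_poly (Suc b) = of_nat (Suc b) + 2 * (\<Sum>i = 1..b. of_nat (Suc b - i) * p ^ i)"
    by (simp add: torus_poly_def)
  then show ?thesis
    unfolding * by (simp add: torus_poly_def algebra_simps)
qed

text \<open>Applying the braiding once more multiplies coefficients by \<open>p\<close>. This
  identity and the next remove such products, so that the inductions on powers reduce to linear
  arithmetic.\<close>

lemma p_psum: "p * psum b = psum b + p ^ b - 1"
  by (induction b) (simp_all add: psum_Suc algebra_simps)

lemma p_torus_poly:
  "p * torus_poly b = torus_poly b + 2 * psum b + 2 * p ^ b - 2 - of_nat b - of_nat b * p"
proof (induction b)
  case (Suc b)
  have "p * torus_poly (Suc b) = p * torus_poly b + 2 * (p * psum b) + 2 * p ^ Suc b - p"
    unfolding torus_poly_Suc by (simp add: algebra_simps)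
  then show ?case
    unfolding Suc p_psum by (simp add: torus_poly_Suc psum_Suc algebra_simps)
qed simp

lemma B_linear [simp]:
  "B (v + v') = B v + B v'" "B (c *s v) = c *s B v" "B (v - v') = B v - B v'" "B (- v) = - B v"
  by (rule vec.add vec.scale vec.diff vec.neg)+

text \<open>The block has characteristic polynomial (x - 1)(x - p); \<open>psum b\<close> stands for
  (1 - p^b)/(1 - p).\<close>

lemma B_power_01:
  "(B ^^ b) (tens e0 e1) = (psum b + p ^ b) *s tens e0 e1 + psum b *s tens e1 e0"
  "(B ^^ b) (tens e1 e0) = (1 - p ^ b - psum b) *s tens e0 e1 + (1 - psum b) *s tens e1 e0"
proof (induction b)
  case (Suc b)
  note eq = p_psum[of b]
  { case 1 show ?case
    using eq unfolding funpow.simps o_apply Suc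
    by (simp add: braiding_ee psum_Suc vec_eq_iff) }
  { case 2 show ?case
    using eq unfolding funpow.simps o_apply Suc
    by (simp add: braiding_ee psum_Suc vec_eq_iff) }
qed simp_all

lemma B_power_13:
  "(B ^^ b) (tens e1 e3) = (psum b + p ^ b) *s tens e1 e3 + psum b *s tens e3 e1"
  "(B ^^ b) (tens e3 e1) = (1 - p ^ b - psum b) *s tens e1 e3 + (1 - psum b) *s tens e3 e1"
proof (induction b)
  case (Suc b)
  note eq = p_psum[of b]
  { case 1 show ?case
    using eq unfolding funpow.simps o_apply Suc
    by (simp add: braiding_ee psum_Suc vec_eq_iff) }
  { case 2 show ?case
    using eq unfolding funpow.simps o_apply Suc
    by (simp add: braiding_ee psum_Suc vec_eq_iff) }
qed simp_all

text \<open>Here the eigenvalue 1 is double and the block is a Jordan block, hence the linear growth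
  in \<open>b\<close>.\<close>

lemma B_power_02:
  "(B ^^ b) (tens e0 e2) = (of_nat b + 1) *s tens e0 e2 + of_nat b *s tens e2 e0"
  "(B ^^ b) (tens e2 e0) = - of_nat b *s tens e0 e2 + (1 - of_nat b) *s tens e2 e0"
proof (induction b)
  case (Suc b)
  { case 1 show ?case
    unfolding funpow.simps o_apply Suc by (simp add: braiding_ee vec_eq_iff algebra_simps) }
  { case 2 show ?case
    unfolding funpow.simps o_apply Suc by (simp add: braiding_ee vec_eq_iff algebra_simps) }
qed simp_all

lemma B_power_23:
  "(B ^^ b) (tens e2 e3) = (of_nat b + 1) *s tens e2 e3 + of_nat b *s tens e3 e2"
  "(B ^^ b) (tens e3 e2) = - of_nat b *s tens e2 e3 + (1 - of_nat b) *s tens e3 e2"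
proof (induction b)
  case (Suc b)
  { case 1 show ?case
    unfolding funpow.simps o_apply Suc by (simp add: braiding_ee vec_eq_iff algebra_simps) }
  { case 2 show ?case
    unfolding funpow.simps o_apply Suc by (simp add: braiding_ee vec_eq_iff algebra_simps) }
qed simp_all

lemma B_power_diag:
  "(B ^^ b) (tens e0 e0) = tens e0 e0" "(B ^^ b) (tens e1 e1) = p ^ b *s tens e1 e1"
  "(B ^^ b) (tens e2 e2) = tens e2 e2" "(B ^^ b) (tens e3 e3) = tens e3 e3"
  by (induction b) (simp_all add: braiding_ee mult.commute)

text \<open>The eigenvalues are 1, three times, and \<open>p\<close>, with a Jordan block of size
  two for 1. All four columns are proved together, since the braiding mixes them at each
  step.\<close>

lemma B_power_03:
  "(B ^^ b) (tens e0 e3) = (torus_poly b + psum b + p ^ b + of_nat b) *s tens e0 e3 +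
    (torus_poly b - psum b + of_nat b) *s tens e3 e0 + (torus_poly b + of_nat b) *s tens e1 e2 +
    (torus_poly b + of_nat b) *s tens e2 e1"
  "(B ^^ b) (tens e3 e0) = (torus_poly b + psum b + p ^ b - of_nat b - 1) *s tens e0 e3 +
    (torus_poly b + 1 - psum b - of_nat b) *s tens e3 e0 + (torus_poly b - of_nat b) *s tens e1 e2 +
    (torus_poly b - of_nat b) *s tens e2 e1"
  "(B ^^ b) (tens e1 e2) = (1 - torus_poly b - psum b - p ^ b) *s tens e0 e3 +
    (psum b - torus_poly b) *s tens e3 e0 + (1 - torus_poly b) *s tens e1 e2 - torus_poly b *s tens e2 e1"
  "(B ^^ b) (tens e2 e1) = (1 - torus_poly b - psum b - p ^ b) *s tens e0 e3 +
    (psum b - torus_poly b) *s tens e3 e0 + (1 - torus_poly b) *s tens e2 e1 - torus_poly b *s tens e1 e2"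
proof (induction b)
  case (Suc b)
  note eq = p_psum[of b] p_torus_poly[of b]
  { case 1 show ?case
    using eq unfolding funpow.simps o_apply Suc
    by (simp add: braiding_ee psum_Suc torus_poly_Suc vec_eq_iff) }
  { case 2 show ?case
    using eq unfolding funpow.simps o_apply Suc
    by (simp add: braiding_ee psum_Suc torus_poly_Suc vec_eq_iff) }
  { case 3 show ?case
    using eq unfolding funpow.simps o_apply Suc
    by (simp add: braiding_ee psum_Suc torus_poly_Suc vec_eq_iff) }
  { case 4 show ?case
    using eq unfolding funpow.simps o_apply Suc
    by (simp add: braiding_ee psum_Suc torus_poly_Suc vec_eq_iff) }
qed simp_all

text \<open>The coefficients of the coordinate vectors in \<open>e0\<close>, ..., \<open>e3\<close>
  are the components of the dual functionals.\<close>

lemma dual_basis: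
  obtains f0 f1 f2 f3 where
    "\<And>v. v = dot f0 v *s e0 + dot f1 v *s e1 + dot f2 v *s e2 + dot f3 v *s e3"
proof -
  have "\<forall>l. \<exists>a b c d. axis l 1 = a *s e0 + b *s e1 + c *s e2 + d *s e3"
    using e_expand by blast
  then obtain f0 f1 f2 f3 where f:
    "axis l 1 = f0 l *s e0 + f1 l *s e1 + f2 l *s e2 + f3 l *s e3" for l
    by metis
  have "v = dot (vec_lambda f0) v *s e0 + dot (vec_lambda f1) v *s e1 +
      dot (vec_lambda f2) v *s e2 + dot (vec_lambda f3) v *s e3" for v
  proof -
    have "v = (\<Sum>l\<in>UNIV. v $ l *s axis l 1)"
      by (simp add: basis_expansion)
    then show ?thesis
      unfolding f
      by (simp add: dot_def vec.scale_right_distrib sum.distrib vec.scale_sum_left mult.commute)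
  qed
  then show ?thesis
    using that by blast
qed

lemma B_power_linear [simp]:
  "(B ^^ b) (v + v') = (B ^^ b) v + (B ^^ b) v'" "(B ^^ b) (c *s v) = c *s (B ^^ b) v"
  by (induction b) simp_all

text \<open>A partial trace does not depend on the basis: \<open>pt\<close> is the same trace taken
  over \<open>e0\<close>, ..., \<open>e3\<close>, with the pivot absorbed into the dual
  functionals.\<close>

lemma partial_trace:
  "(\<Sum>k\<in>UNIV. \<Sum>l\<in>UNIV. (B ^^ b) (tens v (axis l 1)) $ (i, k) * act n q \<phi> (pivot n) $ l $ k) =
    - torus_poly b * v $ i"
proof -
  obtain f0 f1 f2 f3 where f:
    "\<And>v. v = dot f0 v *s e0 + dot f1 v *s e1 + dot f2 v *s e2 + dot f3 v *s e3"
    using dual_basis by blast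
  have "dot f0 e = a \<and> dot f1 e = b \<and> dot f2 e = c \<and> dot f3 e = d"
    if "e = a *s e0 + b *s e1 + c *s e2 + d *s e3" for e a b c d
  proof -
    have "dot f0 e *s e0 + dot f1 e *s e1 + dot f2 e *s e2 + dot f3 e *s e3 =
        a *s e0 + b *s e1 + c *s e2 + d *s e3"
      using trans[OF f[of e, symmetric] that] .
    then have "(dot f0 e - a) *s e0 + (dot f1 e - b) *s e1 +
        (dot f2 e - c) *s e2 + (dot f3 e - d) *s e3 = 0"
      by (simp add: vec.scale_left_diff_distrib algebra_simps)
    from e_indep[OF this] show ?thesis by simp
  qed
  from this[of e0 1 0 0 0] this[of e1 0 1 0 0] this[of e2 0 0 1 0] this[of e3 0 0 0 1]
  have dot_e:
    "dot f0 e0 = 1" "dot f1 e0 = 0" "dot f2 e0 = 0" "dot f3 e0 = 0"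
    "dot f0 e1 = 0" "dot f1 e1 = 1" "dot f2 e1 = 0" "dot f3 e1 = 0"
    "dot f0 e2 = 0" "dot f1 e2 = 0" "dot f2 e2 = 1" "dot f3 e2 = 0"
    "dot f0 e3 = 0" "dot f1 e3 = 0" "dot f2 e3 = 0" "dot f3 e3 = 1"
    by simp_all
  let ?h = "\<lambda>f. f v* act n q \<phi> (pivot n)"
  define pt where "pt v = contract (?h f0) ((B ^^ b) (tens v e0)) +
    contract (?h f1) ((B ^^ b) (tens v e1)) + contract (?h f2) ((B ^^ b) (tens v e2)) +
    contract (?h f3) ((B ^^ b) (tens v e3))" for v
  have pt_linear: "pt (v + v') = pt v + pt v'" "pt (c *s v) = c *s pt v" for v v' c
    by (simp_all add: pt_def vec.scale_right_distrib)
  \<comment> \<open>With the pivot signs, the diagonal coefficients for \<open>e0\<close> give -1 +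
    (psum b + p^b) + (b + 1) - (torus_poly b + psum b + p^b + b); everything but
    \<open>torus_poly b\<close> cancels, and likewise for the others.\<close>
  have pt_e: "pt e0 = - torus_poly b *s e0" "pt e1 = - torus_poly b *s e1"
    "pt e2 = - torus_poly b *s e2" "pt e3 = - torus_poly b *s e3"
    by (simp_all add: pt_def B_power_01 B_power_02 B_power_03 B_power_13 B_power_23 B_power_diag
        dot_matrix dot_e)
  have pt: "pt v = - torus_poly b *s v"
    by (subst (1 2) f[of v], unfold pt_linear pt_e) (simp add: vec_eq_iff algebra_simps)
  have axis: "axis l 1 = f0 $ l *s e0 + f1 $ l *s e1 + f2 $ l *s e2 + f3 $ l *s e3" for l
    using f[of "axis l 1"] by (simp add: dot_def axis_def if_distrib cong: if_cong)
  have c: "(\<Sum>k\<in>UNIV. \<Sum>l\<in>UNIV. f $ l * T $ (i, k) * M $ l $ k) = contract (f v* M) T $ i"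
    for f :: "'k ^ 'd" and T :: "'k ^ ('d \<times> 'd)" and M
    by (simp add: contract_def vector_matrix_mult_def sum_distrib_left mult_ac)
  show ?thesis
    using arg_cong[OF pt, of "\<lambda>x. x $ i"] unfolding axis
    by (simp add: sum.distrib distrib_right c pt_def)
qed

end

section \<open>The closed braid\<close>

lemma sum_lists_Suc:
  "(\<Sum>m\<in>{m :: 'a::finite list. length m = Suc k}. f m) =
    (\<Sum>a\<in>UNIV. \<Sum>m\<in>{m. length m = k}. f (a # m))"
proof -
  have *: "{m :: 'a list. length m = Suc k} = (\<lambda>(a, m). a # m) ` (UNIV \<times> {m. length m = k})"
    by (auto simp: length_Suc_conv image_iff)
  have "inj_on (\<lambda>(a, m). a # m) (UNIV \<times> {m :: 'a list. length m = k})"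
    by (auto simp: inj_on_def)
  then show ?thesis
    unfolding * by (subst sum.reindex) (simp_all add: sum.cartesian_product case_prod_unfold)
qed

lemma src_cross_pow [simp]: "src (cross_pow b) = [Up, Up]"
  and tgt_cross_pow [simp]: "tgt (cross_pow b) = [Up, Up]"
  and composable_cross_pow [simp]: "composable (cross_pow b)"
  and writhe_cross_pow [simp]: "writhe (cross_pow b) = int b"
  by (induction b) simp_all

lemma RT_cross_pow:
  "RT n q \<phi> (cross_pow b) [i, k] [j, l] = ((*v) (braiding n q \<phi>) ^^ b) (axis (j, l) 1) $ (i, k)"
proof (induction b arbitrary: i k)
  case (Suc b)
  show ?case
    by (simp add: sum_lists_Suc Suc matrix_vector_mult_def sum.cartesian_product case_prod_unfold)
qed (auto simp: axis_def)

text \<open>Cup and cap tie the labels of the closed strand together; the pivot enters once, through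
  the right-hand cap \<open>EvR\<close>.\<close>

lemma RT_torus_cut:
  "RT n q \<phi> (torus_cut b) [i] [j] =
    (\<Sum>k\<in>UNIV. \<Sum>l\<in>UNIV. ((*v) (braiding n q \<phi>) ^^ b) (tens (axis j 1) (axis l 1)) $ (i, k) *
      act n q \<phi> (pivot n) $ l $ k)"
proof -
  have t: "tens (axis j 1) (axis l 1) = (axis (j, l) 1 :: 'a ^ _)" for j l
    by (auto simp: tens_def axis_def vec_eq_iff)
  have d1: "(\<Sum>a\<in>UNIV. (if i = a then 1 else 0) * f a) = (f i :: 'a)"
    "(\<Sum>a\<in>UNIV. f a * (if i = a then 1 else 0)) = (f i :: 'a)"
    "(\<Sum>a\<in>UNIV. (if a = i then 1 else 0) * f a) = (f i :: 'a)"
    "(\<Sum>a\<in>UNIV. f a * (if a = i then 1 else 0)) = (f i :: 'a)" for f and i :: 'b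
    by (simp_all add: if_distrib[of "\<lambda>x. _ * x"] if_distrib[of "\<lambda>x. x * _"] cong: if_cong)
  show ?thesis
    unfolding torus_cut_def t
    by (simp add: sum_lists_Suc RT_cross_pow d1 mult_ac flip: sum_distrib_left sum_distrib_right)
qed

lemma torus_cut_simps [simp]:
  "composable (torus_cut b)" "src (torus_cut b) = [Up]" "tgt (torus_cut b) = [Up]"
  "writhe (torus_cut b) = int b"
  by (simp_all add: torus_cut_def)

context L_mod
begin

text \<open>An equivalence, because it must both evaluate the definite description in
  \<open>link_invariant\<close> and show that its value satisfies the predicate.\<close>

lemma is_link_scalar_torus_cut_iff:
  "is_link_scalar n q \<phi> (torus_cut b) c \<longleftrightarrow> c = (- 1) ^ (b + 1) * torus_poly b"
proof -
  have RT: "RT n q \<phi> (torus_cut b) [i] [j] = mat (- torus_poly b) $ i $ j" for i j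
    unfolding RT_torus_cut partial_trace by (simp add: axis_def mat_def)
  have mat_eq: "mat x = (mat y :: 'k ^ 'd ^ 'd) \<longleftrightarrow> x = y" for x y
    by (auto simp: mat_def vec_eq_iff)
  have "is_link_scalar n q \<phi> (torus_cut b) c \<longleftrightarrow>
      (mat (- torus_poly b) :: 'k ^ 'd ^ 'd) = mat (c * (- 1) ^ b)"
    by (auto simp: is_link_scalar_def twist_eq mat_eq RT power_int_of_nat simp flip: vec_eq_iff)
  also have "\<dots> \<longleftrightarrow> c = (- 1) ^ (b + 1) * torus_poly b"
    unfolding mat_eq by (cases "even b") auto
  finally show ?thesis .
qed

end

theorem lemma7p11:
  fixes q :: "'k :: {alg_closed_field, field_char_0}"
    and n b :: nat
    and \<phi> :: "'k falg set \<Rightarrow> 'k ^ 'd ^ ('d :: finite)"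
  assumes "2 * n > 2" and "even n"
    and "primitive_root_of_unity (2 * n) q"
    and "is_L n q n (n + 1) \<phi>"
    and "b \<ge> 1"
  shows "is_link_scalar n q \<phi> (torus_cut b) (link_invariant n q \<phi> (torus_cut b)) \<and>
    link_invariant n q \<phi> (torus_cut b) =
      (- 1) ^ (b + 1) * (of_nat b + 2 * (\<Sum>i = 1..b - 1. of_nat (b - i) * q powi (- int i)))"
proof -
  obtain w where "w \<noteq> 0" "act n q \<phi> X1 *v w = 0" "act n q \<phi> X2 *v w = 0"
    "act n q \<phi> K1 *v w = q ^ n *s w" "act n q \<phi> K2 *v w = q ^ (n + 1) *s w"
    and simple: "simple_uq_module n q \<phi>"
    using assms(4) unfolding is_L_def by blast
  moreover have "uq_module n q \<phi>"
    using simple by (simp add: simple_uq_module_def)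
  ultimately interpret L_mod n q \<phi> w
    using assms by unfold_locales simp_all
  have "torus_poly b = of_nat b + 2 * (\<Sum>i = 1..b - 1. of_nat (b - i) * q powi (- int i))"
    by (simp add: torus_poly_def power_int_minus power_inverse)
  then show ?thesis
    unfolding link_invariant_def is_link_scalar_torus_cut_iff by simp
qed

end
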